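(* There exists $C>0$ such that, for every $\boldsymbol\beta=(\beta_0,\beta_\pi)\in\mathbb R^2$ and every $f\in\mathcal V$, \[ \mathfrak a_{\boldsymbol\beta}[f,f]\ge-C\left(1+|\beta_0^-|^4+|\beta_\pi^-|^4\right)\|f\|_{\mathcal H}^2 . \] Moreover, there exist $c>0$ and $\mu_0>0$ such that \[ \inf\sigma\bigl(A_{(-\mu,0)}\bigr)\le-c\mu^4,\qquad \mu\ge\mu_0 . \] (Thus the fourth power in the first inequality is sharp.)
   Context: Let $\omega(\varphi)=(\sin\varphi)^{1/2}$ and $\mathcal H=L^2((0,\pi),\omega\,d\varphi)$. Let $\mathfrak a_0[f,g]=4\int_0^\pi\omega f'\,\overline{g'}\,d\varphi$ with form domain $\mathcal V=\{f\in\mathcal H: f\in H^1_{\mathrm{loc}}(0,\pi),\ \int_0^\pi\omega|f'|^2\,d\varphi<\infty\}$. Elements of $\mathcal V$ have well-defined endpoint values $f(0),f(\pi)$ (limits at the endpoints, depending continuously on $f\in\mathcal V$). For $\boldsymbol\beta=(\beta_0,\beta_\pi)\in\mathbb R^2$ define on $\mathcal V$ the Robin form $\mathfrak a_{\boldsymbol\beta}[f,g]=\mathfrak a_0[f,g]+\beta_0f(0)\overline{g(0)}+\beta_\pi f(\pi)\overline{g(\pi)}$; it is closed and lower semibounded and $A_{\boldsymbol\beta}$ denotes the associated self-adjoint operator on $\mathcal H$ (with compact resolvent). $\sigma$ denotes the spectrum and $\beta^-=\max\{-\beta,0\}$ the negative part. *)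

theory Defs
  imports "HOL-Analysis.Analysis"
begin

text \<open>
  Elements of the function spaces below are Borel functions \<open>real \<Rightarrow> complex\<close>, of which only the
  restriction to \<open>(0, \<pi>)\<close> matters, and which are identified when they agree almost everywhere.
  Every Lebesgue-measurable function agrees almost everywhere with a Borel one.
\<close>

definition leb :: "real measure" where
  "leb = restrict_space lborel {0<..<pi}"

definition omega :: "real \<Rightarrow> real" where
  "omega \<phi> = sqrt (sin \<phi>)"

definition wleb :: "real measure" where
  "wleb = density leb (\<lambda>\<phi>. ennreal (omega \<phi>))"

section \<open>The Hilbert space \<open>L\<^sup>2((0, \<pi>), \<omega> d\<phi>)\<close>\<close>

definition H_space :: "(real \<Rightarrow> complex) set" where
  "H_space = {f \<in> borel_measurable wleb. integrable wleb (\<lambda>\<phi>. (cmod (f \<phi>))\<^sup>2)}"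

definition H_inner :: "(real \<Rightarrow> complex) \<Rightarrow> (real \<Rightarrow> complex) \<Rightarrow> complex" where
  "H_inner f g = (LINT \<phi>|wleb. f \<phi> * cnj (g \<phi>))"

definition H_norm :: "(real \<Rightarrow> complex) \<Rightarrow> real" where
  "H_norm f = sqrt (LINT \<phi>|wleb. (cmod (f \<phi>))\<^sup>2)"

section \<open>Local Sobolev functions\<close>

definition test_functions :: "(real \<Rightarrow> real) set" where
  "test_functions = {\<psi>. (\<forall>n x. (deriv ^^ n) \<psi> field_differentiable (at x)) \<and>
     (\<exists>K. compact K \<and> K \<subseteq> {0<..<pi} \<and> (\<forall>x. x \<notin> K \<longrightarrow> \<psi> x = 0))}"

definition L2_loc :: "(real \<Rightarrow> complex) set" where
  "L2_loc = {f \<in> borel_measurable leb.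
     \<forall>K. compact K \<and> K \<subseteq> {0<..<pi} \<longrightarrow> set_integrable leb K (\<lambda>\<phi>. (cmod (f \<phi>))\<^sup>2)}"

definition is_weak_deriv :: "(real \<Rightarrow> complex) \<Rightarrow> (real \<Rightarrow> complex) \<Rightarrow> bool" where
  "is_weak_deriv f g \<longleftrightarrow> (\<forall>\<psi>\<in>test_functions.
     (LINT \<phi>|leb. f \<phi> * of_real (deriv \<psi> \<phi>)) = - (LINT \<phi>|leb. g \<phi> * of_real (\<psi> \<phi>)))"

definition H1_loc :: "(real \<Rightarrow> complex) set" where
  "H1_loc = {f \<in> L2_loc. \<exists>g\<in>L2_loc. is_weak_deriv f g}"

text \<open>For \<open>f\<close> in \<open>H1_loc\<close> the weak derivative is unique up to null sets.\<close>

definition weak_deriv :: "(real \<Rightarrow> complex) \<Rightarrow> real \<Rightarrow> complex" where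
  "weak_deriv f = (SOME g. g \<in> L2_loc \<and> is_weak_deriv f g)"

section \<open>The Robin forms\<close>

definition form_dom :: "(real \<Rightarrow> complex) set" where
  "form_dom = {f \<in> H_space. f \<in> H1_loc \<and>
     integrable leb (\<lambda>\<phi>. omega \<phi> * (cmod (weak_deriv f \<phi>))\<^sup>2)}"

text \<open>
  Point evaluation at an endpoint refers to the continuous representative, which is unique on
  \<open>(0, \<pi>)\<close>; its values outside this interval do not enter the one-sided limits.
\<close>

definition cont_rep :: "(real \<Rightarrow> complex) \<Rightarrow> real \<Rightarrow> complex" where
  "cont_rep f = (SOME u. continuous_on {0<..<pi} u \<and> (AE \<phi> in leb. u \<phi> = f \<phi>))"

definition value_0 :: "(real \<Rightarrow> complex) \<Rightarrow> complex" where
  "value_0 f = Lim (at_right 0) (cont_rep f)"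

definition value_pi :: "(real \<Rightarrow> complex) \<Rightarrow> complex" where
  "value_pi f = Lim (at_left pi) (cont_rep f)"

definition form0 :: "(real \<Rightarrow> complex) \<Rightarrow> (real \<Rightarrow> complex) \<Rightarrow> complex" where
  "form0 f g = 4 * (LINT \<phi>|leb. of_real (omega \<phi>) * weak_deriv f \<phi> * cnj (weak_deriv g \<phi>))"

fun robin_form :: "real \<times> real \<Rightarrow> (real \<Rightarrow> complex) \<Rightarrow> (real \<Rightarrow> complex) \<Rightarrow> complex" where
  "robin_form (\<beta>\<^sub>0, \<beta>\<^sub>\<pi>) f g = form0 f g
     + of_real \<beta>\<^sub>0 * value_0 f * cnj (value_0 g)
     + of_real \<beta>\<^sub>\<pi> * value_pi f * cnj (value_pi g)"

section \<open>The associated operator and its spectrum\<close>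

text \<open>
  Operators in the Hilbert space are represented by their graphs. The operator associated with
  the form sends \<open>f\<close> to the (almost everywhere unique, as the form domain is dense) \<open>h\<close>
  representing the functional given by \<open>f\<close>; its domain consists of those \<open>f\<close> for which \<open>h\<close> exists.
\<close>

type_synonym operator_graph = "((real \<Rightarrow> complex) \<times> (real \<Rightarrow> complex)) set"

definition robin_op :: "real \<times> real \<Rightarrow> operator_graph" where
  "robin_op \<beta> = {(f, h). f \<in> form_dom \<and> h \<in> H_space \<and>
     (\<forall>g\<in>form_dom. robin_form \<beta> f g = H_inner h g)}"

text \<open>
  \<open>z\<close> is in the resolvent set if \<open>A - z\<close> maps the domain of \<open>A\<close> bijectively onto the Hilbert space
  with bounded inverse; the norm estimate expresses both injectivity and boundedness of the inverse.
\<close>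

definition resolvent_set :: "operator_graph \<Rightarrow> complex set" where
  "resolvent_set A = {z.
     (\<forall>h\<in>H_space. \<exists>(f, k)\<in>A. AE \<phi> in wleb. k \<phi> - z * f \<phi> = h \<phi>) \<and>
     (\<exists>K. \<forall>(f, k)\<in>A. H_norm f \<le> K * H_norm (\<lambda>\<phi>. k \<phi> - z * f \<phi>))}"

definition spectrum :: "operator_graph \<Rightarrow> complex set" where
  "spectrum A = - resolvent_set A"

text \<open>
  The infimum of the spectrum of a self-adjoint operator, whose spectrum consists of real numbers.
  It is taken in the extended reals, so that it is \<open>\<infinity>\<close> for an empty set.
\<close>

definition inf_spectrum :: "operator_graph \<Rightarrow> ereal" where
  "inf_spectrum A = (INF t\<in>{t::real. complex_of_real t \<in> spectrum A}. ereal t)"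

definition neg_part :: "real \<Rightarrow> real" where
  "neg_part b = max (- b) 0"

end

theory Submission
  imports Defs
begin

text \<open>
  Near an endpoint the weight behaves like the square root of the distance \<open>t\<close>, so \<open>1 / \<omega>\<close> has an
  integral of order \<open>t\<^sup>1\<^sup>/\<^sup>2\<close> over the interval of length \<open>t\<close> ending there. By the
  Cauchy--Schwarz inequality an element \<open>f\<close> of the form domain changes by at most a multiple of
  \<open>t\<^sup>1\<^sup>/\<^sup>4 \<parallel>f'\<parallel>\<close> on that interval (\<open>energy_increment\<close>). Comparing \<open>f(0)\<close> with the values on an
  interval of length \<open>\<delta>\<^sup>2\<close>, which has weighted measure of order \<open>\<delta>\<^sup>3\<close>, gives the trace inequality
  \<open>|f(0)|\<^sup>2 \<le> C (\<delta>\<^sup>-\<^sup>3 \<parallel>f\<parallel>\<^sup>2 + \<delta> \<parallel>f'\<parallel>\<^sup>2)\<close> (\<open>endpoint_trace_inequality\<close>). Taking \<open>\<delta>\<close> of order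
  \<open>1 / (1 + \<beta>\<^sup>-)\<close> lets the energy absorb the boundary term at the price \<open>\<beta>\<^sup>- / \<delta>\<^sup>3\<close>, which is of
  fourth order (\<open>robin_form_lower_bound\<close>).

  The exponent cannot be lowered: the function \<open>exp (- m\<^sup>2 \<phi>)\<close> with \<open>m = \<mu> / 8\<close> lives on exactly
  the length scale \<open>\<mu>\<^sup>-\<^sup>2\<close> and has Rayleigh quotient at most \<open>- \<mu>\<^sup>4 / 1024\<close>. That the infimum of
  the spectrum lies below every Rayleigh quotient is shown by a direct argument. The best lower
  bound \<open>\<kappa>\<^sub>0\<close> of the form is finite; if it were in the resolvent set, the bounded inverse of
  \<open>A - \<kappa>\<^sub>0\<close> together with the nonnegativity of the shifted form would give a strictly better
  lower bound (\<open>resolvent_point_improves_lower_bound\<close>). So \<open>\<kappa>\<^sub>0\<close> is in the spectrum.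

  Both parts rest on the fact that a function with a weak derivative is, up to a null set, a
  primitive of it (\<open>weak_deriv_imp_primitive\<close>). This gives meaning to the endpoint values, makes
  them and the weak derivative linear, and identifies them for the trial function. Its proof, by
  the lemmas of du Bois-Reymond, starts from smooth approximations of indicators of intervals.
\<close>

section \<open>Smooth functions with compact support\<close>

text \<open>
  Smoothness is counted by a recursion that peels off one derivative at a time, because the
  closure under sums, products and reciprocals is then a plain induction; iterating the choice
  operator \<open>deriv\<close> directly would require knowing all derivatives in closed form.
\<close>

primrec times_diff :: "nat \<Rightarrow> (real \<Rightarrow> real) \<Rightarrow> bool" where
  "times_diff 0 f = True"
| "times_diff (Suc n) f = (\<exists>f'. (\<forall>x. (f has_real_derivative f' x) (at x)) \<and> times_diff n f')"

lemma times_diff_Suc_D: "times_diff (Suc n) f \<Longrightarrow> times_diff n f"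
  by (induction n arbitrary: f) (simp, metis times_diff.simps(2))

lemma times_diff_const: "times_diff n (\<lambda>x. c)"
proof (induction n arbitrary: c)
  case (Suc n)
  show ?case using Suc[of 0] by (auto intro!: exI[of _ "\<lambda>_. 0"])
qed simp

lemma times_diff_add: "times_diff n f \<Longrightarrow> times_diff n g \<Longrightarrow> times_diff n (\<lambda>x. f x + g x)"
proof (induction n arbitrary: f g)
  case (Suc n)
  then obtain f' g' where "\<forall>x. (f has_real_derivative f' x) (at x)" "times_diff n f'"
    "\<forall>x. (g has_real_derivative g' x) (at x)" "times_diff n g'" by auto
  with Suc.IH show ?case
    by (auto intro!: exI[of _ "\<lambda>x. f' x + g' x"] derivative_intros)
qed simp

lemma times_diff_mult: "times_diff n f \<Longrightarrow> times_diff n g \<Longrightarrow> times_diff n (\<lambda>x. f x * g x)"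
proof (induction n arbitrary: f g)
  case (Suc n)
  then obtain f' g' where *: "\<forall>x. (f has_real_derivative f' x) (at x)" "times_diff n f'"
    "\<forall>x. (g has_real_derivative g' x) (at x)" "times_diff n g'" by auto
  have "times_diff n (\<lambda>x. f' x * g x + g' x * f x)"
    using * Suc.prems[THEN times_diff_Suc_D] by (intro times_diff_add Suc.IH)
  moreover have "\<forall>x. ((\<lambda>x. f x * g x) has_real_derivative f' x * g x + g' x * f x) (at x)"
    using * by (auto intro!: derivative_eq_intros)
  ultimately show ?case by auto
qed simp

lemma times_diff_inverse:
  assumes "\<And>x. f x \<noteq> 0"
  shows "times_diff n f \<Longrightarrow> times_diff n (\<lambda>x. inverse (f x))"
proof (induction n)
  case (Suc n)
  then obtain f' where *: "\<forall>x. (f has_real_derivative f' x) (at x)" "times_diff n f'" by auto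
  have "times_diff n (\<lambda>x. (-1) * (f' x * (inverse (f x) * inverse (f x))))"
    using Suc.IH[OF times_diff_Suc_D[OF Suc.prems]] *
    by (intro times_diff_mult times_diff_const)
  moreover have "\<forall>x. ((\<lambda>x. inverse (f x)) has_real_derivative
      (-1) * (f' x * (inverse (f x) * inverse (f x)))) (at x)"
    using * assms by (auto intro!: derivative_eq_intros)
  ultimately show ?case unfolding times_diff.simps by (intro exI conjI)
qed simp

lemma times_diff_affine: "times_diff n f \<Longrightarrow> times_diff n (\<lambda>x. f (c * x + d))"
proof (induction n arbitrary: f)
  case (Suc n)
  then obtain f' where *: "\<forall>x. (f has_real_derivative f' x) (at x)" "times_diff n f'" by auto
  have "((\<lambda>x. f (c * x + d)) has_real_derivative f' (c * x + d) * c) (at x)" for x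
    by (rule DERIV_chain'[where g = f]) (auto intro!: derivative_eq_intros simp: *)
  moreover have "times_diff n (\<lambda>x. f' (c * x + d) * c)"
    by (intro times_diff_mult times_diff_const Suc.IH *)
  ultimately show ?case unfolding times_diff.simps by (intro exI conjI allI)
qed simp

lemma times_diff_imp_field_differentiable:
  "times_diff (Suc n) f \<Longrightarrow> (deriv ^^ n) f field_differentiable (at x)"
proof (induction n arbitrary: f)
  case (Suc n)
  then obtain f' where *: "\<forall>x. (f has_real_derivative f' x) (at x)" "times_diff (Suc n) f'" by auto
  then have "deriv f = f'" by (auto intro: DERIV_imp_deriv)
  with Suc.IH[OF *(2)] show ?case by (simp add: funpow_swap1)
qed (auto simp: field_differentiable_def)

text \<open>
  For \<open>p = 1\<close> this is Cauchy's flat function \<open>exp (- 1 / x)\<close>. The polynomial factor in \<open>1 / x\<close>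
  makes the family closed under differentiation, so that smoothness at the origin only ever has
  to be checked for first derivatives.
\<close>

definition flat_exp :: "real poly \<Rightarrow> real \<Rightarrow> real" where
  "flat_exp p x = (if 0 < x then poly p (1 / x) * exp (- (1 / x)) else 0)"

lemma poly_div_exp_at_top: "((\<lambda>t. poly p t * exp (- t)) \<longlongrightarrow> 0) (at_top :: real filter)"
proof -
  have "((\<lambda>t. \<Sum>i\<le>degree p. coeff p i * (t ^ i / exp t)) \<longlongrightarrow> (\<Sum>i\<le>degree p. coeff p i * 0)) at_top"
    by (intro tendsto_sum tendsto_mult tendsto_const tendsto_power_div_exp_0)
  then show ?thesis
    by (simp add: poly_altdef sum_distrib_right exp_minus divide_inverse mult.assoc)
qed

text \<open>
  At the origin the difference quotient of a member of the family is, up to the substitution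
  \<open>t = 1 / x\<close>, a polynomial times \<open>exp (- t)\<close> for \<open>t \<rightarrow> \<infinity>\<close>.
\<close>

lemma flat_exp_deriv:
  "(flat_exp p has_real_derivative flat_exp ([:0, 0, 1:] * (p - pderiv p)) x) (at x)"
proof -
  consider "x < 0" | "x = 0" | "0 < x" by linarith
  then show ?thesis
  proof cases
    case 1
    have "((\<lambda>_. 0) has_real_derivative 0) (at x)" by simp
    moreover have "eventually (\<lambda>y. y \<in> {..<0}) (nhds x)"
      using 1 by (intro eventually_nhds_in_open) auto
    then have "eventually (\<lambda>y. flat_exp p y = 0) (nhds x)"
      by eventually_elim (auto simp: flat_exp_def)
    ultimately show ?thesis using 1
      by (subst DERIV_cong_ev[OF refl _ refl, where g = "\<lambda>_. 0"]) (auto simp: flat_exp_def)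
  next
    case 2
    have "((\<lambda>t. poly [:0, 1:] t * poly p t * exp (- t)) \<longlongrightarrow> 0) (at_top :: real filter)"
      using poly_div_exp_at_top[of "[:0, 1:] * p"] by simp
    then have "((\<lambda>y. poly [:0, 1:] (inverse y) * poly p (inverse y) * exp (- (inverse y))) \<longlongrightarrow> 0)
        (at_right (0::real))"
      by (rule filterlim_compose[OF _ filterlim_inverse_at_top_right])
    moreover have "eventually (\<lambda>y. poly [:0, 1:] (inverse y) * poly p (inverse y) * exp (- (inverse y))
        = flat_exp p y / y) (at_right (0::real))"
      by (auto simp: eventually_at_filter flat_exp_def field_simps)
    ultimately have "((\<lambda>y. flat_exp p y / y) \<longlongrightarrow> 0) (at_right (0::real))"
      by (rule Lim_transform_eventually)
    moreover have "eventually (\<lambda>y. 0 = flat_exp p y / y) (at_left (0::real))"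
      by (auto simp: eventually_at_filter flat_exp_def)
    then have "((\<lambda>y. flat_exp p y / y) \<longlongrightarrow> 0) (at_left (0::real))"
      by (rule Lim_transform_eventually[OF tendsto_const])
    ultimately have "((\<lambda>y. flat_exp p y / y) \<longlongrightarrow> 0) (at (0::real))"
      by (simp add: filterlim_split_at)
    then show ?thesis using 2 by (simp add: has_field_derivative_iff flat_exp_def)
  next
    case 3
    have "((\<lambda>x. poly p (1 / x) * exp (- (1 / x))) has_real_derivative
        poly ([:0, 0, 1:] * (p - pderiv p)) (1 / x) * exp (- (1 / x))) (at x)"
      using 3 by (auto intro!: derivative_eq_intros DERIV_chain2[OF poly_DERIV] simp: field_simps power2_eq_square)
    moreover have "eventually (\<lambda>y. y \<in> {0<..}) (nhds x)"
      using 3 by (intro eventually_nhds_in_open) auto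
    then have "eventually (\<lambda>y. flat_exp p y = poly p (1 / y) * exp (- (1 / y))) (nhds x)"
      by eventually_elim (auto simp: flat_exp_def)
    ultimately show ?thesis using 3
      by (subst DERIV_cong_ev[OF refl _ refl, where g = "\<lambda>x. poly p (1 / x) * exp (- (1 / x))"])
        (simp_all add: flat_exp_def)
  qed
qed

lemma times_diff_flat_exp: "times_diff n (flat_exp p)"
proof (induction n arbitrary: p)
  case (Suc n)
  then show ?case using flat_exp_deriv by auto
qed simp

definition bump :: "real \<Rightarrow> real \<Rightarrow> real \<Rightarrow> real" where
  "bump a b x = flat_exp 1 (x - a) * flat_exp 1 (b - x)"

lemma bump_pos: "a < x \<Longrightarrow> x < b \<Longrightarrow> bump a b x > 0"
  and bump_zero: "x \<le> a \<or> b \<le> x \<Longrightarrow> bump a b x = 0"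
  and bump_nonneg: "bump a b x \<ge> 0"
  by (auto simp: bump_def flat_exp_def)

lemma times_diff_bump: "times_diff n (bump a b)"
proof -
  have "times_diff n (\<lambda>x. flat_exp 1 (1 * x + (- a)) * flat_exp 1 ((-1) * x + b))"
    by (intro times_diff_mult times_diff_affine times_diff_flat_exp)
  then show ?thesis by (simp add: bump_def[abs_def])
qed

text \<open>
  As \<open>n \<rightarrow> \<infinity>\<close> these functions increase to the indicator of \<open>(a, b)\<close> while vanishing outside this
  interval. Integrals over intervals are therefore limits of integrals against test functions, by
  dominated convergence.
\<close>

definition plateau :: "real \<Rightarrow> real \<Rightarrow> nat \<Rightarrow> real \<Rightarrow> real" where
  "plateau a b n x = 1 - inverse (1 + real n * bump a b x)"

lemma times_diff_plateau: "times_diff k (plateau a b n)"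
proof -
  have "1 + real n * bump a b x \<noteq> 0" for x
    using bump_nonneg[of a b x] by (smt (verit) mult_nonneg_nonneg of_nat_0_le_iff)
  then have "times_diff k (\<lambda>x. 1 + (-1) * inverse (1 + real n * bump a b x))"
    by (intro times_diff_add times_diff_mult times_diff_inverse times_diff_const times_diff_bump)
  then show ?thesis by (simp add: plateau_def[abs_def])
qed

lemma plateau_bounds: "0 \<le> plateau a b n x" "plateau a b n x \<le> 1"
proof -
  have "real n * bump a b x \<ge> 0" using bump_nonneg by simp
  then show "0 \<le> plateau a b n x" "plateau a b n x \<le> 1"
    unfolding plateau_def by (auto simp: inverse_le_1_iff)
qed

lemma plateau_outside: "x \<notin> {a<..<b} \<Longrightarrow> plateau a b n x = 0"
  using bump_zero[of x a b] by (auto simp: plateau_def)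

lemma plateau_pos: "x \<in> {a<..<b} \<Longrightarrow> 0 < n \<Longrightarrow> 0 < plateau a b n x"
  using bump_pos[of a x b] unfolding plateau_def
  by (auto simp: inverse_less_1_iff)

lemma plateau_tendsto: "(\<lambda>n. plateau a b n x) \<longlonglongrightarrow> indicator {a<..<b} x"
proof (cases "x \<in> {a<..<b}")
  case True
  then have "0 < bump a b x" by (simp add: bump_pos)
  then have "filterlim (\<lambda>n. 1 + real n * bump a b x) at_top sequentially"
    by (intro filterlim_tendsto_add_at_top[OF tendsto_const] filterlim_at_top_mult_tendsto_pos[OF tendsto_const] 
      filterlim_real_sequentially)
  then have "(\<lambda>n. 1 - inverse (1 + real n * bump a b x)) \<longlonglongrightarrow> 1 - 0"
    by (intro tendsto_diff tendsto_const tendsto_inverse_0_at_top)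
  then show ?thesis using True by (simp add: plateau_def)
qed (simp add: plateau_outside)

lemma plateau_test_function: "0 < a \<Longrightarrow> b < pi \<Longrightarrow> plateau a b n \<in> test_functions"
  unfolding test_functions_def
  using times_diff_imp_field_differentiable[OF times_diff_plateau] plateau_outside[of _ a b n]
  by (auto intro!: exI[of _ "{a..b}"])

lemma test_function_deriv:
  "\<psi> \<in> test_functions \<Longrightarrow> (\<psi> has_real_derivative deriv \<psi> x) (at x)"
  unfolding test_functions_def DERIV_deriv_iff_field_differentiable
  by (metis (mono_tags, lifting) funpow_0 mem_Collect_eq)

lemma deriv_zero_outside:
  fixes \<psi> :: "real \<Rightarrow> real"
  assumes "closed K" "\<And>y. y \<notin> K \<Longrightarrow> \<psi> y = 0" "x \<notin> K"
  shows "deriv \<psi> x = 0"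
proof -
  have "eventually (\<lambda>y. y \<in> - K) (nhds x)"
    using assms by (intro eventually_nhds_in_open) auto
  then have "eventually (\<lambda>y. \<psi> y = 0) (nhds x)" by eventually_elim (use assms in auto)
  then have "(\<psi> has_real_derivative 0) (at x)"
    by (subst DERIV_cong_ev[OF refl _ refl, where g = "\<lambda>_. 0"]) auto
  then show ?thesis by (rule DERIV_imp_deriv)
qed

lemma deriv_test_function:
  assumes "\<psi> \<in> test_functions" shows "deriv \<psi> \<in> test_functions"
proof -
  from assms obtain K where K: "compact K" "K \<subseteq> {0<..<pi}" "\<forall>x. x \<notin> K \<longrightarrow> \<psi> x = 0"
    and d: "\<forall>n x. (deriv ^^ n) \<psi> field_differentiable (at x)"
    by (auto simp: test_functions_def)
  have "deriv \<psi> x = 0" if "x \<notin> K" for x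
    using deriv_zero_outside[of K \<psi>] K that by (simp add: compact_imp_closed)
  moreover have "(deriv ^^ n) (deriv \<psi>) field_differentiable (at x)" for n x
    using d[rule_format, of "Suc n" x] by (simp add: funpow_swap1)
  ultimately show ?thesis using K by (auto simp: test_functions_def)
qed

lemma test_function_continuous: "\<psi> \<in> test_functions \<Longrightarrow> continuous_on S \<psi>"
  using test_function_deriv by (meson DERIV_isCont continuous_at_imp_continuous_on)

lemma test_function_support:
  assumes "\<psi> \<in> test_functions"
  obtains a b where "0 < a" "a < b" "b < pi" "\<And>x. x \<notin> {a<..<b} \<Longrightarrow> \<psi> x = 0"
proof -
  from assms obtain K where K: "compact K" "K \<subseteq> {0<..<pi}" "\<forall>x. x \<notin> K \<longrightarrow> \<psi> x = 0"
    by (auto simp: test_functions_def)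
  show ?thesis
  proof (cases "K = {}")
    case True
    with K that[of 1 2] pi_gt3 show ?thesis by auto
  next
    case False
    obtain l u where l: "l \<in> K" "\<And>x. x \<in> K \<Longrightarrow> l \<le> x" and u: "u \<in> K" "\<And>x. x \<in> K \<Longrightarrow> x \<le> u"
      using compact_attains_inf[OF K(1) False] compact_attains_sup[OF K(1) False] by metis
    from l u K have "0 < l" "u < pi" "l \<le> u" by auto
    then show ?thesis using l(2) u(2) K(3)
      by (intro that[of "l / 2" "(u + pi) / 2"]) (auto, smt (verit) field_sum_of_halves, smt (verit) field_sum_of_halves)
  qed
qed

text \<open>
  The primitive starting from the left end of the support has compact support again exactly
  because the total integral vanishes. These are the derivatives of test functions, the only
  functions a weakly constant function is tested against.
\<close>

lemma test_function_antideriv: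
  assumes h: "\<eta> \<in> test_functions" and zero: "integral {0..pi} \<eta> = 0"
  obtains \<psi> where "\<psi> \<in> test_functions" "deriv \<psi> = \<eta>"
proof -
  obtain a b where ab: "0 < a" "a < b" "b < pi" "\<And>x. x \<notin> {a<..<b} \<Longrightarrow> \<eta> x = 0"
    using test_function_support[OF h] by blast
  have cont: "continuous_on S \<eta>" for S by (rule test_function_continuous[OF h])
  have int: "\<eta> integrable_on {c..d}" for c d by (intro integrable_continuous_interval cont)
  define \<psi> where "\<psi> x = (if x \<le> a then 0 else integral {a..x} \<eta>)" for x
  have ipos: "integral {c..d} \<eta> = 0" if "d \<le> a \<or> b \<le> c" for c d
  proof -
    have "integral {c..d} \<eta> = integral {c..d} (\<lambda>_. 0)"
      using that ab(4) by (intro Henstock_Kurzweil_Integration.integral_cong) force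
    then show ?thesis by simp
  qed
  have \<psi>_alt: "\<psi> x = integral {c..x} \<eta>" if "c \<le> a" for c x
  proof (cases "x \<le> a")
    case True then show ?thesis using ipos[of x c] by (simp add: \<psi>_def)
  next
    case False
    then have "integral {c..a} \<eta> + integral {a..x} \<eta> = integral {c..x} \<eta>"
      using that by (intro Henstock_Kurzweil_Integration.integral_combine int) auto
    then show ?thesis using False ipos[of a c] by (simp add: \<psi>_def)
  qed
  have der: "(\<psi> has_real_derivative \<eta> x) (at x)" for x
  proof -
    define c d where "c = min a x - 1" and "d = x + 1"
    have "((\<lambda>u. integral {c..u} \<eta>) has_real_derivative \<eta> x) (at x within {c..d})"
      by (rule integral_has_real_derivative[OF cont]) (auto simp: c_def d_def)
    then have "((\<lambda>u. integral {c..u} \<eta>) has_real_derivative \<eta> x) (at x)"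
      by (subst (asm) at_within_interior) (auto simp: c_def d_def)
    moreover have "(\<lambda>u. integral {c..u} \<eta>) = \<psi>"
      using \<psi>_alt[of c] by (auto simp: c_def)
    ultimately show ?thesis by simp
  qed
  then have d: "deriv \<psi> = \<eta>" by (auto intro: DERIV_imp_deriv)
  have "(deriv ^^ n) \<psi> field_differentiable (at x)" for n x
  proof (cases n)
    case 0 then show ?thesis using der by (auto simp: field_differentiable_def)
  next
    case (Suc m)
    then show ?thesis using h d by (simp add: funpow_swap1 test_functions_def)
  qed
  moreover have "\<psi> x = 0" if "x \<notin> {a..b}" for x
  proof (cases "x \<le> a")
    case False
    with that have "x > b" by auto
    have "integral {0..x} \<eta> + integral {x..max x pi} \<eta> = integral {0..max x pi} \<eta>"
      by (rule Henstock_Kurzweil_Integration.integral_combine) (use ab \<open>x > b\<close> int in auto)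
    moreover have "integral {0..pi} \<eta> + integral {pi..max x pi} \<eta> = integral {0..max x pi} \<eta>"
      by (rule Henstock_Kurzweil_Integration.integral_combine) (use int in auto)
    moreover have "integral {x..max x pi} \<eta> = 0" "integral {pi..max x pi} \<eta> = 0"
      using ipos ab \<open>x > b\<close> by auto
    ultimately show ?thesis using \<psi>_alt[of 0 x] ab zero by simp
  qed (simp add: \<psi>_def)
  moreover have "compact {a..b}" "{a..b} \<subseteq> {0<..<pi}" using ab by auto
  ultimately have "\<psi> \<in> test_functions" unfolding test_functions_def by blast
  with d that show ?thesis by blast
qed

section \<open>The fundamental lemma of the calculus of variations\<close>

lemma leb_integral: "(LINT x|leb. f x) = (LINT x:{0<..<pi}|lborel. f x)"
  for f :: "real \<Rightarrow> 'a :: {banach, second_countable_topology}"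
  unfolding leb_def set_lebesgue_integral_def by (subst integral_restrict_space) auto

lemma leb_integrable: "integrable leb f \<longleftrightarrow> set_integrable lborel {0<..<pi} f"
  for f :: "real \<Rightarrow> 'a :: {banach, second_countable_topology}"
  unfolding leb_def set_integrable_def by (subst integrable_restrict_space) auto

lemma AE_leb: "(AE x in leb. P x) \<longleftrightarrow> (AE x in lborel. x \<in> {0<..<pi} \<longrightarrow> P x)"
  unfolding leb_def by (subst AE_restrict_space_iff) auto

lemma measurable_leb_iff:
  "f \<in> borel_measurable leb \<longleftrightarrow> (\<lambda>x. indicator {0<..<pi} x *\<^sub>R f x) \<in> borel_measurable lborel"
  for f :: "real \<Rightarrow> 'a :: real_normed_vector"
  unfolding leb_def by (subst borel_measurable_restrict_space_iff) auto

lemma sets_leb: "sets leb = sets (restrict_space borel {0<..<pi})"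
  by (simp add: leb_def sets_restrict_space)

lemma space_leb: "space leb = {0<..<pi}"
  by (simp add: leb_def space_restrict_space)

lemma measurable_leb_borel: "f \<in> borel_measurable borel \<Longrightarrow> f \<in> borel_measurable leb"
  unfolding leb_def by (intro measurable_restrict_space1) simp

definition locally_integrable :: "(real \<Rightarrow> complex) \<Rightarrow> bool" where
  "locally_integrable f \<longleftrightarrow> (\<forall>a b. 0 < a \<longrightarrow> b < pi \<longrightarrow> set_integrable lborel {a..b} f)"

lemma locally_integrableD: "locally_integrable f \<Longrightarrow> 0 < a \<Longrightarrow> b < pi \<Longrightarrow> set_integrable lborel {a..b} f"
  by (auto simp: locally_integrable_def)

lemma locally_integrable_diff:
  "locally_integrable f \<Longrightarrow> locally_integrable g \<Longrightarrow> locally_integrable (\<lambda>x. f x - g x)"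
  by (auto simp: locally_integrable_def)

lemma locally_integrable_continuous:
  "continuous_on {0<..<pi} f \<Longrightarrow> locally_integrable f"
  unfolding locally_integrable_def
  by (intro allI impI borel_integrable_atLeastAtMost') (erule continuous_on_subset, auto)

lemma L2_loc_imp_locally_integrable:
  assumes "f \<in> L2_loc" shows "locally_integrable f"
  unfolding locally_integrable_def
proof (intro allI impI)
  fix a b :: real assume ab: "0 < a" "b < pi"
  then have sub: "{a..b} \<subseteq> {0<..<pi}" by auto
  have eq: "indicator {a..b} x *\<^sub>R indicator {0<..<pi} x *\<^sub>R f x = indicator {a..b} x *\<^sub>R f x"
    and eq': "indicator {0<..<pi} x *\<^sub>R indicator {a..b} x *\<^sub>R c = indicator {a..b} x *\<^sub>R c"
    for x and c :: real using sub by (auto simp: indicator_def)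
  from assms have m: "f \<in> borel_measurable leb" and "set_integrable leb {a..b} (\<lambda>x. (cmod (f x))\<^sup>2)"
    using sub by (auto simp: L2_loc_def)
  then have "integrable lborel (\<lambda>x. indicator {a..b} x *\<^sub>R (cmod (f x))\<^sup>2)"
    unfolding set_integrable_def leb_integrable eq' by blast
  then have I: "integrable lborel (\<lambda>x. indicator {a..b} x *\<^sub>R 1 + indicator {a..b} x *\<^sub>R (cmod (f x))\<^sup>2)"
    using borel_integrable_atLeastAtMost'[of a b "\<lambda>_. 1::real"] unfolding set_integrable_def
    by (intro Bochner_Integration.integrable_add) auto
  have "(\<lambda>x. indicator {a..b} x *\<^sub>R (indicator {0<..<pi} x *\<^sub>R f x)) \<in> borel_measurable lborel"
    using m unfolding measurable_leb_iff by measurable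
  then have M: "(\<lambda>x. indicator {a..b} x *\<^sub>R f x) \<in> borel_measurable lborel"
    by (simp only: eq)
  show "set_integrable lborel {a..b} f"
    unfolding set_integrable_def
  proof (rule Bochner_Integration.integrable_bound[OF I M], rule AE_I2)
    fix x
    have "0 \<le> (cmod (f x) - 1)\<^sup>2" by simp
    then have "2 * cmod (f x) \<le> 1 + (cmod (f x))\<^sup>2" by (simp add: power2_diff)
    then have "cmod (f x) \<le> 1 + (cmod (f x))\<^sup>2" using norm_ge_zero[of "f x"] by linarith
    then show "norm (indicator {a..b} x *\<^sub>R f x) \<le> norm (indicator {a..b} x *\<^sub>R 1 + indicator {a..b} x *\<^sub>R (cmod (f x))\<^sup>2)"
      by (auto simp: indicator_def)
  qed
qed

lemma set_integrable_mult_continuous: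
  fixes w :: "real \<Rightarrow> complex" and \<psi> :: "real \<Rightarrow> real"
  assumes w: "set_integrable lborel {a..b} w" and c: "continuous_on {a..b} \<psi>"
  shows "set_integrable lborel {a..b} (\<lambda>x. w x * of_real (\<psi> x))"
proof -
  have "compact (\<psi> ` {a..b})" by (intro compact_continuous_image c) auto
  then obtain B where B: "\<And>x. x \<in> {a..b} \<Longrightarrow> \<bar>\<psi> x\<bar> \<le> B"
    using compact_imp_bounded by (fastforce simp: bounded_iff)
  have "(\<lambda>x. indicator {a..b} x *\<^sub>R \<psi> x) \<in> borel_measurable borel"
    using borel_integrable_atLeastAtMost'[OF c] unfolding set_integrable_def by auto
  then have "(\<lambda>x. (indicator {a..b} x *\<^sub>R w x) * of_real (indicator {a..b} x *\<^sub>R \<psi> x)) \<in> borel_measurable lborel"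
    using w unfolding set_integrable_def by measurable
  moreover have "integrable lborel (\<lambda>x. B *\<^sub>R norm (indicator {a..b} x *\<^sub>R w x))"
    using w unfolding set_integrable_def by (intro integrable_scaleR_right integrable_norm)
  moreover have "AE x in lborel. norm ((indicator {a..b} x *\<^sub>R w x) * of_real (indicator {a..b} x *\<^sub>R \<psi> x))
      \<le> norm (B *\<^sub>R norm (indicator {a..b} x *\<^sub>R w x))"
  proof (rule AE_I2)
    fix x
    have "x \<in> {a..b} \<Longrightarrow> cmod (w x) * \<bar>\<psi> x\<bar> \<le> \<bar>B\<bar> * cmod (w x)"
      using B[of x] by (subst mult.commute, intro mult_right_mono) auto
    then show "norm ((indicator {a..b} x *\<^sub>R w x) * of_real (indicator {a..b} x *\<^sub>R \<psi> x))
      \<le> norm (B *\<^sub>R norm (indicator {a..b} x *\<^sub>R w x))"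
      by (auto simp: indicator_def norm_mult abs_mult)
  qed
  ultimately have "integrable lborel (\<lambda>x. (indicator {a..b} x *\<^sub>R w x) * of_real (indicator {a..b} x *\<^sub>R \<psi> x))"
    using Bochner_Integration.integrable_bound by blast
  moreover have "(indicator {a..b} x *\<^sub>R w x) * of_real (indicator {a..b} x *\<^sub>R \<psi> x) = indicator {a..b} x *\<^sub>R (w x * of_real (\<psi> x))" for x
    by (auto simp: indicator_def)
  ultimately show ?thesis unfolding set_integrable_def by (simp only:)
qed

lemma test_integral_Icc:
  fixes w :: "real \<Rightarrow> complex"
  assumes "0 < a" "b < pi" "\<And>x. x \<notin> {a<..<b} \<Longrightarrow> \<psi> x = 0"
  shows "(LINT x|leb. w x * of_real (\<psi> x)) = (LINT x:{a..b}|lborel. w x * of_real (\<psi> x))"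
proof -
  have "indicator {0<..<pi} x *\<^sub>R (w x * of_real (\<psi> x)) = indicator {a..b} x *\<^sub>R (w x * of_real (\<psi> x))" for x
    using assms by (auto simp: indicator_def)
  then show ?thesis unfolding leb_integral set_lebesgue_integral_def by (intro Bochner_Integration.integral_cong refl)
qed

lemma integrable_mult_test_function:
  fixes w :: "real \<Rightarrow> complex"
  assumes w: "locally_integrable w" and \<psi>: "\<psi> \<in> test_functions"
  shows "integrable leb (\<lambda>x. w x * of_real (\<psi> x))"
proof -
  obtain a b where ab: "0 < a" "a < b" "b < pi" "\<And>x. x \<notin> {a<..<b} \<Longrightarrow> \<psi> x = 0"
    using test_function_support[OF \<psi>] by blast
  have "indicator {0<..<pi} x *\<^sub>R (w x * of_real (\<psi> x)) = indicator {a..b} x *\<^sub>R (w x * of_real (\<psi> x))" for x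
    using ab by (auto simp: indicator_def)
  then show ?thesis
    using set_integrable_mult_continuous[OF locally_integrableD[OF w ab(1,3)] test_function_continuous[OF \<psi>]]
    unfolding leb_integrable set_integrable_def by (simp only:)
qed

lemma Ioo_integral_eq_Icc:
  fixes w :: "real \<Rightarrow> complex"
  assumes "a \<le> b" shows "(LINT x:{a<..<b}|lborel. w x) = (LINT x:{a..b}|lborel. w x)"
  using assms interval_integral_Icc[of a b w] interval_integral_Ioo[of a b w] by simp

text \<open>
  Testing against \<open>plateau a b n\<close> and letting \<open>n\<close> tend to infinity replaces the test function by
  the indicator of the interval.
\<close>

lemma integral_zero_if_weakly_zero:
  assumes w: "locally_integrable w"
    and zero: "\<And>\<psi>. \<psi> \<in> test_functions \<Longrightarrow> (LINT x|leb. w x * of_real (\<psi> x)) = 0"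
    and ab: "0 < a" "a \<le> b" "b < pi"
  shows "integral {a..b} w = 0"
proof -
  note wi = locally_integrableD[OF w ab(1,3)]
  have "(\<lambda>n. LINT x|lborel. indicator {a..b} x *\<^sub>R (w x * of_real (plateau a b n x)))
      \<longlonglongrightarrow> (LINT x|lborel. indicator {a<..<b} x *\<^sub>R w x)"
  proof (rule integral_dominated_convergence[where w = "\<lambda>x. norm (indicator {a..b} x *\<^sub>R w x)"])
    show "(\<lambda>x. indicator {a<..<b} x *\<^sub>R w x) \<in> borel_measurable lborel"
      using set_integrable_subset[OF wi, of "{a<..<b}"] by (auto simp: set_integrable_def greaterThanLessThan_subseteq_atLeastAtMost_iff)
    show "(\<lambda>x. indicator {a..b} x *\<^sub>R (w x * of_real (plateau a b n x))) \<in> borel_measurable lborel" for n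
      by (rule borel_measurable_integrable[OF set_integrable_mult_continuous[OF wi
          test_function_continuous[OF plateau_test_function[OF ab(1,3)]], unfolded set_integrable_def]])
    show "integrable lborel (\<lambda>x. norm (indicator {a..b} x *\<^sub>R w x))"
      using wi unfolding set_integrable_def by (rule integrable_norm)
    show "AE x in lborel. (\<lambda>n. indicator {a..b} x *\<^sub>R (w x * of_real (plateau a b n x)))
      \<longlonglongrightarrow> indicator {a<..<b} x *\<^sub>R w x"
    proof (rule AE_I2)
      fix x
      have "(\<lambda>n. indicator {a..b} x *\<^sub>R (w x * of_real (plateau a b n x))) \<longlonglongrightarrow> 
         indicator {a..b} x *\<^sub>R (w x * of_real (indicator {a<..<b} x))"
        by (intro tendsto_intros plateau_tendsto)
      then show "(\<lambda>n. indicator {a..b} x *\<^sub>R (w x * of_real (plateau a b n x)))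
          \<longlonglongrightarrow> indicator {a<..<b} x *\<^sub>R w x"
        by (cases "x \<in> {a<..<b}") auto
    qed
    show "AE x in lborel. norm (indicator {a..b} x *\<^sub>R (w x * of_real (plateau a b n x)))
        \<le> norm (indicator {a..b} x *\<^sub>R w x)" for n
      using plateau_bounds[of a b n]
      by (intro AE_I2) (auto simp: indicator_def norm_mult mult_left_le)
  qed
  moreover have "(LINT x|lborel. indicator {a..b} x *\<^sub>R (w x * of_real (plateau a b n x))) = 0" for n
    using test_integral_Icc[where w = w and \<psi> = "plateau a b n", OF ab(1,3) plateau_outside] zero[OF plateau_test_function[OF ab(1,3)], of n]
    by (simp add: set_lebesgue_integral_def)
  ultimately have "(\<lambda>n. 0) \<longlonglongrightarrow> (LINT x:{a<..<b}|lborel. w x)"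
    by (simp add: set_lebesgue_integral_def)
  then have "(LINT x:{a<..<b}|lborel. w x) = 0" by (simp add: LIMSEQ_const_iff)
  then show ?thesis
    using Ioo_integral_eq_Icc[OF ab(2), of w] set_borel_integral_eq_integral(2)[OF wi] by simp
qed

text \<open>
  All integrals of \<open>w\<close> over compact subintervals vanish, hence so do all the averages over
  \<open>[x, x + h]\<close>; by Lebesgue differentiation these averages converge to \<open>w x\<close> for almost every
  \<open>x\<close>. Working on the intervals \<open>(1/(n+1), \<pi> - 1/(n+1))\<close> first keeps the function integrable.
\<close>

lemma weakly_zero_imp_AE_zero:
  assumes w: "locally_integrable w"
    and zero: "\<And>\<psi>. \<psi> \<in> test_functions \<Longrightarrow> (LINT x|leb. w x * of_real (\<psi> x)) = 0"
  shows "AE x in leb. w x = 0"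
proof -
  have step: "AE x in lborel. x \<in> {a<..<b} \<longrightarrow> w x = 0" if ab: "0 < a" "b < pi" for a b
  proof -
    \<comment> \<open>Cutting \<open>w\<close> off makes it integrable on every interval, as Lebesgue differentiation requires.\<close>
    define f where "f x = (if x \<in> {a..b} then w x else 0)" for x
    have "w integrable_on {a..b}"
      using set_borel_integral_eq_integral(1)[OF locally_integrableD[OF w ab]] .
    then have "f integrable_on UNIV"
      unfolding f_def by (subst integrable_restrict_UNIV)
    then have "f integrable_on cbox c d" for c d
      by (rule integrable_on_subcbox) auto
    then obtain N where N: "negligible N" "\<And>x e. x \<notin> N \<Longrightarrow> 0 < e \<Longrightarrow>
        \<exists>d>0. \<forall>h. 0 < h \<and> h < d \<longrightarrow> norm (integral (cbox x (x + h *\<^sub>R One)) f /\<^sub>R h ^ DIM(real) - f x) < e"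
      by (rule integrable_ccontinuous_explicit) blast
    have *: "w x = 0" if x: "x \<in> {a<..<b}" "x \<notin> N" for x
    proof (rule ccontr)
      assume "w x \<noteq> 0"
      then have pos: "0 < norm (w x)" by simp
      obtain d where d: "d > 0" "\<And>h. 0 < h \<Longrightarrow> h < d \<Longrightarrow>
          norm (integral (cbox x (x + h *\<^sub>R One)) f /\<^sub>R h ^ DIM(real) - f x) < norm (w x)"
        using N(2)[OF x(2) pos] by blast
      define h where "h = min (d / 2) (b - x)"
      have h: "0 < h" "h < d" "x + h \<le> b" using d(1) x by (auto simp: h_def min_def field_simps)
      have "integral {x..x + h} f = integral {x..x + h} w"
        using x h by (intro Henstock_Kurzweil_Integration.integral_cong) (auto simp: f_def)
      also have "\<dots> = 0"
        using x h ab by (intro integral_zero_if_weakly_zero[OF w zero]) auto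
      finally have "norm (f x) < norm (w x)" using d(2)[OF h(1,2)] by simp
      then show False using x by (simp add: f_def)
    qed
    from N(1) have "N \<in> null_sets (completion lborel)" by (simp add: negligible_iff_null_sets)
    then obtain N' where "N' \<in> null_sets lborel" "N \<subseteq> N'" by (auto simp: null_sets_completion_iff2)
    then show ?thesis using * by (intro AE_I'[of N']) auto
  qed
  have "AE x in lborel. \<forall>n. x \<in> {1 / real (Suc n)<..<pi - 1 / real (Suc n)} \<longrightarrow> w x = 0"
    unfolding AE_all_countable by (intro allI step) auto
  then show ?thesis unfolding AE_leb
  proof eventually_elim
    case (elim x)
    show ?case
    proof
      assume x: "x \<in> {0<..<pi}"
      then have "0 < min x (pi - x)" by auto
      then obtain n where "1 / real (Suc n) < min x (pi - x)"
        using nat_approx_posE by blast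
      then show "w x = 0" using elim by (auto dest!: spec[of _ n])
    qed
  qed
qed

section \<open>Weak derivatives and continuous representatives\<close>

lemma field_differentiable_imp_times_diff:
  "(\<And>n x. (deriv ^^ n) f field_differentiable (at x)) \<Longrightarrow> times_diff k f"
proof (induction k arbitrary: f)
  case (Suc k)
  have "(f has_real_derivative deriv f x) (at x)" for x
    using Suc.prems[of 0 x] by (simp add: DERIV_deriv_iff_field_differentiable)
  moreover have "times_diff k (deriv f)"
    using Suc.prems[of "Suc _"] by (intro Suc.IH) (simp add: funpow_swap1)
  ultimately show ?case by auto
qed simp

lemma test_function_iff:
  "\<psi> \<in> test_functions \<longleftrightarrow> (\<forall>n. times_diff n \<psi>) \<and>
     (\<exists>K. compact K \<and> K \<subseteq> {0<..<pi} \<and> (\<forall>x. x \<notin> K \<longrightarrow> \<psi> x = 0))"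
  unfolding test_functions_def
  using field_differentiable_imp_times_diff[of \<psi>] times_diff_imp_field_differentiable by blast

lemma test_functions_combination:
  assumes "\<phi> \<in> test_functions" "\<psi> \<in> test_functions"
  shows "(\<lambda>x. \<phi> x + c * \<psi> x) \<in> test_functions"
proof -
  from assms obtain K L where "compact K" "K \<subseteq> {0<..<pi}" "\<forall>x. x \<notin> K \<longrightarrow> \<phi> x = 0"
    "compact L" "L \<subseteq> {0<..<pi}" "\<forall>x. x \<notin> L \<longrightarrow> \<psi> x = 0" by (auto simp: test_function_iff)
  then have "compact (K \<union> L) \<and> K \<union> L \<subseteq> {0<..<pi} \<and> (\<forall>x. x \<notin> K \<union> L \<longrightarrow> \<phi> x + c * \<psi> x = 0)"
    by auto
  moreover have "times_diff n (\<lambda>x. \<phi> x + c * \<psi> x)" for n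
    using assms by (intro times_diff_add times_diff_mult times_diff_const) (auto simp: test_function_iff)
  ultimately show ?thesis unfolding test_function_iff by blast
qed

text \<open>
  The integrand of the double integral over the triangle \<open>a \<le> t \<le> x \<le> b\<close>, whose two iterated
  integrals are the two sides of the integration by parts below.
\<close>

lemma triangle_Fubini_integrable:
  fixes g :: "real \<Rightarrow> complex" and \<psi>' :: "real \<Rightarrow> real"
  assumes g: "set_integrable lborel {a..b} g" and c: "continuous_on {a..b} \<psi>'"
  shows "integrable (lborel \<Otimes>\<^sub>M lborel) (\<lambda>(t, x). (if t \<le> x then 1 else 0) *\<^sub>R
    ((indicator {a..b} t *\<^sub>R g t) * of_real (indicator {a..b} x *\<^sub>R \<psi>' x)))"
proof -
  define G where "G t = indicator {a..b} t *\<^sub>R g t" for t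
  define H where "H x = complex_of_real (indicator {a..b} x *\<^sub>R \<psi>' x)" for x
  have Gi: "integrable lborel G" using g by (simp add: set_integrable_def G_def[abs_def])
  have Hi: "integrable lborel H" 
    using borel_integrable_atLeastAtMost'[OF c] unfolding H_def set_integrable_def
    by (rule integrable_of_real)
  have [measurable]: "G \<in> borel_measurable borel" "H \<in> borel_measurable borel"
    using borel_measurable_integrable[OF Gi] borel_measurable_integrable[OF Hi] by simp_all
  have P: "integrable (lborel \<Otimes>\<^sub>M lborel) (\<lambda>(t, x). G t * H x)"
  proof (rule lborel_pair.Fubini_integrable)
    show "(\<lambda>(t, x). G t * H x) \<in> borel_measurable (lborel \<Otimes>\<^sub>M lborel)" by measurable
    show "integrable lborel (\<lambda>t. LINT x|lborel. norm (case (t, x) of (t, x) \<Rightarrow> G t * H x))"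
      using Gi by (simp add: norm_mult)
    show "AE t in lborel. integrable lborel (\<lambda>x. case (t, x) of (t, x) \<Rightarrow> G t * H x)"
      using Hi by simp
  qed
  have "integrable (lborel \<Otimes>\<^sub>M lborel) (\<lambda>(t, x). (if t \<le> x then 1 else 0) *\<^sub>R (G t * H x))"
  proof (rule Bochner_Integration.integrable_bound[OF P])
    show "(\<lambda>(t, x). (if t \<le> x then 1 else 0) *\<^sub>R (G t * H x)) \<in> borel_measurable (lborel \<Otimes>\<^sub>M lborel)"
      by measurable
  qed auto
  then show ?thesis by (simp only: G_def H_def)
qed

text \<open>
  The factor \<open>x \<mapsto> \<integral>\<^sub>a\<^sup>x g\<close> is merely absolutely continuous, so the classical rule does not apply;
  instead the order of integration is exchanged over the triangle \<open>a \<le> t \<le> x \<le> b\<close>, and only the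
  smooth factor is integrated by the fundamental theorem of calculus.
\<close>

lemma integral_by_parts_primitive:
  fixes g :: "real \<Rightarrow> complex"
  assumes g: "set_integrable lborel {a..b} g" and ab: "a \<le> b"
    and \<psi>: "\<And>x. (\<psi> has_real_derivative \<psi>' x) (at x)" and c: "continuous_on {a..b} \<psi>'" and "\<psi> b = 0"
  shows "(LINT x:{a..b}|lborel. integral {a..x} g * of_real (\<psi>' x))
    = - (LINT t:{a..b}|lborel. g t * of_real (\<psi> t))"
proof -
  define k where "k t x = (if t \<le> x then 1 else 0) *\<^sub>R
    ((indicator {a..b} t *\<^sub>R g t) * of_real (indicator {a..b} x *\<^sub>R \<psi>' x))" for t x
  have "integrable (lborel \<Otimes>\<^sub>M lborel) (case_prod k)"
    using triangle_Fubini_integrable[OF g c] by (simp only: k_def[abs_def])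
  then have "(LINT x|lborel. LINT t|lborel. k t x) = (LINT t|lborel. LINT x|lborel. k t x)"
    by (rule lborel_pair.Fubini_integral)
  moreover have "(LINT t|lborel. k t x) = indicator {a..b} x *\<^sub>R (integral {a..x} g * of_real (\<psi>' x))" for x
  proof (cases "x \<in> {a..b}")
    case True
    then have "k t x = (indicator {a..x} t *\<^sub>R g t) * of_real (\<psi>' x)" for t
      by (auto simp: k_def indicator_def)
    then have "(LINT t|lborel. k t x) = (LINT t:{a..x}|lborel. g t) * of_real (\<psi>' x)"
      by (simp only: set_lebesgue_integral_def integral_mult_left_zero)
    also have "(LINT t:{a..x}|lborel. g t) = integral {a..x} g"
      using True by (intro set_borel_integral_eq_integral set_integrable_subset[OF g]) auto
    finally show ?thesis using True by simp
  qed (simp add: k_def)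
  moreover have "(LINT x|lborel. k t x) = indicator {a..b} t *\<^sub>R (- (g t * of_real (\<psi> t)))" for t
  proof (cases "t \<in> {a..b}")
    case True
    then have "k t x = g t * of_real (indicator {t..b} x *\<^sub>R \<psi>' x)" for x
      by (auto simp: k_def indicator_def)
    then have "(LINT x|lborel. k t x) = g t * of_real (LINT x|lborel. indicator {t..b} x *\<^sub>R \<psi>' x)"
      by (simp only: integral_mult_right_zero integral_complex_of_real)
    also have "(LINT x|lborel. indicator {t..b} x *\<^sub>R \<psi>' x) = \<psi> b - \<psi> t"
      using True by (intro integral_FTC_Icc continuous_on_subset[OF c])
        (auto intro!: DERIV_subset[OF \<psi>] simp flip: has_real_derivative_iff_has_vector_derivative)
    finally show ?thesis using True \<open>\<psi> b = 0\<close> by simp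
  qed (simp add: k_def)
  ultimately show ?thesis by (simp add: set_lebesgue_integral_def)
qed

lemma primitive_exists:
  assumes g: "locally_integrable g"
  obtains G where "continuous_on {0<..<pi} G"
    "\<And>x y. 0 < x \<Longrightarrow> x \<le> y \<Longrightarrow> y < pi \<Longrightarrow> G y - G x = integral {x..y} g"
proof -
  define G where "G x = (LBINT t=pi/2..x. g t)" for x :: real
  have G: "G y - G x = integral {x..y} g" if xy: "0 < x" "x \<le> y" "y < pi" for x y
  proof -
    define l u where "l = min x (pi/2)" and "u = max y (pi/2)"
    have "set_integrable lborel {l..u} g"
      using xy by (intro locally_integrableD[OF g]) (auto simp: l_def u_def)
    then have "set_integrable lborel {l<..<u} g" by (rule set_integrable_subset) auto
    moreover have "l \<le> u" by (simp add: l_def u_def)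
    ultimately have "interval_lebesgue_integrable lborel l u g"
      by (simp add: interval_lebesgue_integrable_def)
    moreover have "ereal l = min (ereal (pi/2)) (min (ereal x) (ereal y))" "ereal u = max (ereal (pi/2)) (max (ereal x) (ereal y))"
      using xy by (auto simp: l_def u_def min_def max_def)
    ultimately have "(LBINT t=pi/2..x. g t) + (LBINT t=x..y. g t) = (LBINT t=pi/2..y. g t)"
      by (intro interval_integral_sum) simp
    moreover have "(LBINT t=x..y. g t) = integral {x..y} g"
      using xy by (intro interval_integral_eq_integral locally_integrableD[OF g])
    ultimately show ?thesis by (simp add: G_def algebra_simps)
  qed
  have "isCont G x" if x: "x \<in> {0<..<pi}" for x
  proof -
    obtain a b where ab: "0 < a" "a < x" "x < b" "b < pi" using x by (meson dense greaterThanLessThan_iff)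
    have "g integrable_on {a..b}"
      using ab by (intro set_borel_integral_eq_integral locally_integrableD[OF g])
    then have "continuous_on {a..b} (\<lambda>y. G a + integral {a..y} g)"
      by (intro continuous_intros indefinite_integral_continuous_1)
    moreover have "G a + integral {a..y} g = G y" if "y \<in> {a..b}" for y
      using G[of a y] that ab by (simp add: algebra_simps)
    ultimately have "continuous_on {a..b} G" by (rule continuous_on_eq)
    then show ?thesis using ab by (intro continuous_on_interior[of "{a..b}"]) auto
  qed
  then have "continuous_on {0<..<pi} G" by (simp add: continuous_at_imp_continuous_on)
  with G that show ?thesis by blast
qed

lemma primitive_weak_deriv:
  assumes g: "locally_integrable g" and cont: "continuous_on {0<..<pi} G"
    and G: "\<And>x y. 0 < x \<Longrightarrow> x \<le> y \<Longrightarrow> y < pi \<Longrightarrow> G y - G x = integral {x..y} g"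
  shows "is_weak_deriv G g"
  unfolding is_weak_deriv_def
proof
  fix \<psi> assume \<psi>: "\<psi> \<in> test_functions"
  obtain a b where ab: "0 < a" "a < b" "b < pi" "\<And>x. x \<notin> {a<..<b} \<Longrightarrow> \<psi> x = 0"
    using test_function_support[OF \<psi>] by blast
  note d = test_function_deriv[OF \<psi>] 
  note c = test_function_continuous[OF deriv_test_function[OF \<psi>]]
  note gi = locally_integrableD[OF g ab(1,3)]
  have d0: "deriv \<psi> x = 0" if "x \<notin> {a..b}" for x
    using ab(4) that by (intro deriv_zero_outside[of "{a..b}"]) auto
  have "(LINT x|leb. G x * of_real (deriv \<psi> x)) = (LINT x:{a..b}|lborel. G x * of_real (deriv \<psi> x))"
    unfolding leb_integral set_lebesgue_integral_def
    using ab d0 by (intro Bochner_Integration.integral_cong refl) (auto simp: indicator_def)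
  also have "\<dots> = (LINT x:{a..b}|lborel. G a * of_real (deriv \<psi> x) + integral {a..x} g * of_real (deriv \<psi> x))"
  proof (intro set_lebesgue_integral_cong allI impI)
    fix x assume "x \<in> {a..b}"
    then have "G x = G a + integral {a..x} g" using G[of a x] ab by (simp add: algebra_simps)
    then show "G x * of_real (deriv \<psi> x) = G a * of_real (deriv \<psi> x) + integral {a..x} g * of_real (deriv \<psi> x)"
      by (simp add: algebra_simps)
  qed auto
  also have "\<dots> = (LINT x:{a..b}|lborel. G a * of_real (deriv \<psi> x)) + (LINT x:{a..b}|lborel. integral {a..x} g * of_real (deriv \<psi> x))"
  proof (rule set_integral_add)
    have "continuous_on {a..b} (\<lambda>x. integral {a..x} g)"
      by (intro indefinite_integral_continuous_1 set_borel_integral_eq_integral gi)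
    then show "set_integrable lborel {a..b} (\<lambda>x. integral {a..x} g * of_real (deriv \<psi> x))"
      by (intro borel_integrable_atLeastAtMost' continuous_intros c)
    show "set_integrable lborel {a..b} (\<lambda>x. G a * of_real (deriv \<psi> x))"
      by (intro borel_integrable_atLeastAtMost' continuous_intros c)
  qed
  also have "(LINT x:{a..b}|lborel. G a * of_real (deriv \<psi> x)) = G a * of_real (LINT x|lborel. indicator {a..b} x *\<^sub>R deriv \<psi> x)"
  proof -
    have "indicator {a..b} x *\<^sub>R (G a * of_real (deriv \<psi> x)) = G a * of_real (indicator {a..b} x *\<^sub>R deriv \<psi> x)" for x
      by (auto simp: indicator_def)
    then show ?thesis
      unfolding set_lebesgue_integral_def by (simp only: integral_mult_right_zero integral_complex_of_real)
  qed
  also have "(LINT x|lborel. indicator {a..b} x *\<^sub>R deriv \<psi> x) = \<psi> b - \<psi> a"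
      using ab by (intro integral_FTC_Icc c)
        (auto intro!: DERIV_subset[OF d] simp flip: has_real_derivative_iff_has_vector_derivative)
  also have "(LINT x:{a..b}|lborel. integral {a..x} g * of_real (deriv \<psi> x)) = - (LINT t:{a..b}|lborel. g t * of_real (\<psi> t))"
    by (rule integral_by_parts_primitive[OF gi _ d c]) (use ab in auto)
  also have "(LINT t:{a..b}|lborel. g t * of_real (\<psi> t)) = (LINT t|leb. g t * of_real (\<psi> t))"
    using test_integral_Icc[OF ab(1,3,4), of "\<lambda>x. x" g] by simp
  finally show "(LINT x|leb. G x * of_real (deriv \<psi> x)) = - (LINT t|leb. g t * of_real (\<psi> t))"
    using ab(4)[of a] ab(4)[of b] by simp
qed

text \<open>
  Fix a test function \<open>\<rho>\<close> of nonzero integral. Subtracting a multiple of \<open>\<rho>\<close> turns an arbitrary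
  test function into one of integral zero, that is, into the derivative of a test function, on
  which \<open>w\<close> acts as zero. Hence \<open>w\<close> acts on all test functions like a constant, namely its value
  on \<open>\<rho>\<close> divided by \<open>\<integral> \<rho>\<close>.
\<close>

lemma weakly_constant_imp_AE_constant:
  assumes w: "locally_integrable w"
    and zero: "\<And>\<psi>. \<psi> \<in> test_functions \<Longrightarrow> (LINT x|leb. w x * of_real (deriv \<psi> x)) = 0"
  obtains c where "AE x in leb. w x = c"
proof -
  define \<rho> where "\<rho> = plateau 1 2 1"
  have \<rho>: "\<rho> \<in> test_functions" unfolding \<rho>_def using pi_gt3 by (intro plateau_test_function) auto
  define J where "J \<phi> = (LINT x|leb. w x * of_real (\<phi> x))" for \<phi>
  define I where "I \<phi> = integral {0..pi} \<phi>" for \<phi> :: "real \<Rightarrow> real"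
  have int: "\<phi> integrable_on {0..pi}" if "\<phi> \<in> test_functions" for \<phi>
    by (intro integrable_continuous_interval test_function_continuous that)
  have "I \<rho> \<noteq> 0"
  proof
    assume "I \<rho> = 0"
    then have "\<rho> (3/2) = 0"
      unfolding I_def using pi_gt3 test_function_continuous[OF \<rho>] plateau_bounds(1)[of 1 2 1]
      by (subst (asm) integral_eq_0_iff) (auto simp: \<rho>_def)
    then show False using plateau_pos[of "3/2" 1 2 1] by (simp add: \<rho>_def)
  qed
  define c where "c = J \<rho> / of_real (I \<rho>)"
  have "AE x in leb. w x - c = 0"
  proof (rule weakly_zero_imp_AE_zero)
    show "locally_integrable (\<lambda>x. w x - c)"
      by (intro locally_integrable_diff w locally_integrable_continuous continuous_intros)
    fix \<phi> assume \<phi>: "\<phi> \<in> test_functions"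
    define \<eta> where "\<eta> x = \<phi> x + (- I \<phi> / I \<rho>) * \<rho> x" for x
    have \<eta>: "\<eta> \<in> test_functions"
      unfolding \<eta>_def by (intro test_functions_combination \<phi> \<rho>)
    have "integral {0..pi} \<eta> = I \<phi> + (- I \<phi> / I \<rho>) * I \<rho>"
      unfolding \<eta>_def I_def
      by (intro integral_unique has_integral_add has_integral_mult_right integrable_integral int \<phi> \<rho>)
    then have "integral {0..pi} \<eta> = 0" using \<open>I \<rho> \<noteq> 0\<close> by simp
    then obtain \<psi> where "\<psi> \<in> test_functions" "deriv \<psi> = \<eta>"
      using test_function_antideriv[OF \<eta>] by blast
    then have "J \<eta> = 0" using zero unfolding J_def by blast
    moreover have "J \<eta> = J \<phi> + of_real (- I \<phi> / I \<rho>) * J \<rho>"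
    proof -
      have "w x * of_real (\<eta> x) = w x * of_real (\<phi> x) + of_real (- I \<phi> / I \<rho>) * (w x * of_real (\<rho> x))" for x
        by (simp add: \<eta>_def algebra_simps)
      then show ?thesis unfolding J_def
        using integrable_mult_test_function[OF w \<phi>] integrable_mult_test_function[OF w \<rho>]
        by (simp only: Bochner_Integration.integral_add integrable_mult_right integral_mult_right_zero)
    qed
    ultimately have J\<phi>: "J \<phi> = of_real (I \<phi>) * c" by (simp add: c_def algebra_simps)
    have one: "(LINT x|leb. of_real (\<phi> x)) = complex_of_real (I \<phi>)"
    proof -
      have "(LINT x|leb. complex_of_real (\<phi> x)) = of_real (LINT x|leb. \<phi> x)"
        by (rule integral_complex_of_real)
      also have "(LINT x|leb. \<phi> x) = (LINT x:{0<..<pi}|lborel. \<phi> x)" by (rule leb_integral)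
      also have "\<dots> = (LINT x:{0..pi}|lborel. \<phi> x)"
        using interval_integral_Icc[of 0 pi \<phi>] interval_integral_Ioo[of 0 pi \<phi>] by (simp add: zero_ereal_def)
      also have "\<dots> = I \<phi>" unfolding I_def
        by (intro set_borel_integral_eq_integral borel_integrable_atLeastAtMost' test_function_continuous \<phi>)
      finally show ?thesis .
    qed
    have "(LINT x|leb. (w x - c) * of_real (\<phi> x)) = (LINT x|leb. w x * of_real (\<phi> x) - c * of_real (\<phi> x))"
      by (simp add: algebra_simps)
    also have "\<dots> = J \<phi> - (LINT x|leb. c * of_real (\<phi> x))"
      unfolding J_def
      by (intro Bochner_Integration.integral_diff integrable_mult_test_function w \<phi> locally_integrable_continuous continuous_intros)
    also have "\<dots> = 0" by (simp only: integral_mult_right_zero one J\<phi>) simp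
    finally show "(LINT x|leb. (w x - c) * of_real (\<phi> x)) = 0" .
  qed
  then have "AE x in leb. w x = c" by simp
  then show ?thesis using that by blast
qed

text \<open>
  The du Bois-Reymond lemma: \<open>f\<close> and a primitive \<open>G\<close> of \<open>g\<close> have the same weak derivative, so
  their difference is weakly constant.
\<close>

lemma weak_deriv_imp_primitive:
  assumes f: "locally_integrable f" and g: "locally_integrable g" and fg: "is_weak_deriv f g"
  obtains u where "continuous_on {0<..<pi} u" "AE x in leb. u x = f x"
    "\<And>x y. 0 < x \<Longrightarrow> x \<le> y \<Longrightarrow> y < pi \<Longrightarrow> u y - u x = integral {x..y} g"
proof -
  obtain G where cont: "continuous_on {0<..<pi} G"
    and G: "\<And>x y. 0 < x \<Longrightarrow> x \<le> y \<Longrightarrow> y < pi \<Longrightarrow> G y - G x = integral {x..y} g"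
    using primitive_exists[OF g] by blast
  note Gi = locally_integrable_continuous[OF cont]
  note Gg = primitive_weak_deriv[OF g cont G]
  have "(LINT x|leb. (f x - G x) * of_real (deriv \<psi> x)) = 0" if \<psi>: "\<psi> \<in> test_functions" for \<psi>
  proof -
    note d = deriv_test_function[OF \<psi>]
    have "(LINT x|leb. (f x - G x) * of_real (deriv \<psi> x))
      = (LINT x|leb. f x * of_real (deriv \<psi> x)) - (LINT x|leb. G x * of_real (deriv \<psi> x))"
      unfolding left_diff_distrib
      by (intro Bochner_Integration.integral_diff integrable_mult_test_function f Gi d)
    then show ?thesis using fg Gg \<psi> by (simp add: is_weak_deriv_def)
  qed
  then obtain c where c: "AE x in leb. f x - G x = c"
    using weakly_constant_imp_AE_constant[OF locally_integrable_diff[OF f Gi]] by blast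
  show ?thesis
  proof (rule that[of "\<lambda>x. G x + c"])
    show "continuous_on {0<..<pi} (\<lambda>x. G x + c)" by (intro continuous_intros cont)
    show "AE x in leb. G x + c = f x" using c by eventually_elim (auto simp: algebra_simps)
  qed (use G in auto)
qed

text \<open>
  The subset of \<open>(0, \<pi>)\<close> where two continuous functions differ is open, and a nonempty open set
  is not null.
\<close>

lemma continuous_AE_eq_imp_eq:
  fixes u v :: "real \<Rightarrow> complex"
  assumes "continuous_on {0<..<pi} u" "continuous_on {0<..<pi} v" "AE x in leb. u x = v x"
    and x: "x \<in> {0<..<pi}"
  shows "u x = v x"
proof (rule ccontr)
  define S where "S = {0<..<pi} \<inter> (\<lambda>x. u x - v x) -` (- {0})"
  have op: "open S"
    unfolding S_def by (intro continuous_open_preimage continuous_intros assms)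
  assume "u x \<noteq> v x"
  with x have "S \<noteq> {}" by (auto simp: S_def)
  have "AE x in lborel. x \<notin> S"
    using assms(3) unfolding AE_leb by eventually_elim (auto simp: S_def)
  then have "S \<in> null_sets lborel"
    using op by (subst AE_iff_null_sets) auto
  then have "negligible S"
    unfolding negligible_iff_null_sets by (rule null_sets_completionI)
  then show False using open_not_negligible[OF op \<open>S \<noteq> {}\<close>] by blast
qed

lemma weak_derivD:
  assumes "f \<in> H1_loc"
  shows "weak_deriv f \<in> L2_loc" "is_weak_deriv f (weak_deriv f)"
proof -
  have "\<exists>g. g \<in> L2_loc \<and> is_weak_deriv f g" using assms by (auto simp: H1_loc_def)
  then have "weak_deriv f \<in> L2_loc \<and> is_weak_deriv f (weak_deriv f)"
    unfolding weak_deriv_def by (rule someI_ex)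
  then show "weak_deriv f \<in> L2_loc" "is_weak_deriv f (weak_deriv f)" by auto
qed

text \<open>
  Uniqueness makes the chosen weak derivative linear in \<open>f\<close> and computable for explicit
  functions.
\<close>

lemma weak_deriv_unique:
  assumes g: "g \<in> L2_loc" "is_weak_deriv f g" and h: "h \<in> L2_loc" "is_weak_deriv f h"
  shows "AE x in leb. g x = h x"
proof -
  note li = g(1)[THEN L2_loc_imp_locally_integrable] h(1)[THEN L2_loc_imp_locally_integrable]
  have "AE x in leb. g x - h x = 0"
  proof (rule weakly_zero_imp_AE_zero[OF locally_integrable_diff[OF li]])
    fix \<psi> assume \<psi>: "\<psi> \<in> test_functions"
    have "(LINT x|leb. (g x - h x) * of_real (\<psi> x)) = (LINT x|leb. g x * of_real (\<psi> x)) - (LINT x|leb. h x * of_real (\<psi> x))"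
      unfolding left_diff_distrib by (intro Bochner_Integration.integral_diff integrable_mult_test_function \<psi> li)
    then show "(LINT x|leb. (g x - h x) * of_real (\<psi> x)) = 0"
      using g(2) h(2) \<psi> by (auto simp: is_weak_deriv_def)
  qed
  then show ?thesis by simp
qed

text \<open>
  The choices in \<open>cont_rep\<close> and \<open>weak_deriv\<close> are harmless: any continuous representative is a
  primitive of any weak derivative.
\<close>

lemma cont_rep:
  assumes f: "f \<in> H1_loc"
  shows "continuous_on {0<..<pi} (cont_rep f)" "AE x in leb. cont_rep f x = f x"
    and "0 < x \<Longrightarrow> x \<le> y \<Longrightarrow> y < pi \<Longrightarrow> cont_rep f y - cont_rep f x = integral {x..y} (weak_deriv f)"
proof -
  have "locally_integrable f" "locally_integrable (weak_deriv f)"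
    using f weak_derivD(1)[OF f] by (auto simp: H1_loc_def intro: L2_loc_imp_locally_integrable)
  then obtain u where u: "continuous_on {0<..<pi} u" "AE x in leb. u x = f x"
    "\<And>x y. 0 < x \<Longrightarrow> x \<le> y \<Longrightarrow> y < pi \<Longrightarrow> u y - u x = integral {x..y} (weak_deriv f)"
    using weak_deriv_imp_primitive[OF _ _ weak_derivD(2)[OF f]] by blast
  then have "\<exists>u. continuous_on {0<..<pi} u \<and> (AE x in leb. u x = f x)" by blast
  then have c: "continuous_on {0<..<pi} (cont_rep f) \<and> (AE x in leb. cont_rep f x = f x)"
    unfolding cont_rep_def by (rule someI_ex)
  then show "continuous_on {0<..<pi} (cont_rep f)" "AE x in leb. cont_rep f x = f x" by auto
  have "cont_rep f x = u x" if "x \<in> {0<..<pi}" for x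
  proof (rule continuous_AE_eq_imp_eq[OF _ u(1) _ that])
    show "AE x in leb. cont_rep f x = u x" using conjunct2[OF c] u(2) by eventually_elim auto
  qed (use c in auto)
  then show "cont_rep f y - cont_rep f x = integral {x..y} (weak_deriv f)"
    if "0 < x" "x \<le> y" "y < pi" using u(3)[OF that] that by auto
qed

lemma cont_rep_eqI:
  assumes "f \<in> H1_loc" "continuous_on {0<..<pi} v" "AE x in leb. v x = f x" "x \<in> {0<..<pi}"
  shows "cont_rep f x = v x"
proof (rule continuous_AE_eq_imp_eq[OF cont_rep(1)[OF assms(1)] assms(2) _ assms(4)])
  show "AE x in leb. cont_rep f x = v x"
    using cont_rep(2)[OF assms(1)] assms(3) by eventually_elim auto
qed

section \<open>The weight and the Hilbert space\<close>

lemma omega_pos: "0 < x \<Longrightarrow> x < pi \<Longrightarrow> 0 < omega x"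
  by (simp add: omega_def sin_gt_zero)

lemma omega_measurable [measurable]: "omega \<in> borel_measurable borel"
  unfolding omega_def by measurable

lemma omega_measurable_leb [measurable]: "omega \<in> borel_measurable leb"
  by (rule measurable_leb_borel) simp

lemma AE_omega_nonneg: "AE x in leb. 0 \<le> omega x"
  by (rule AE_I2) (auto simp: space_leb omega_pos less_imp_le)

lemma measurable_wleb: "borel_measurable wleb = borel_measurable leb"
  by (rule measurable_cong_sets) (auto simp: wleb_def)

lemma wleb_integrable:
  fixes h :: "real \<Rightarrow> 'a :: {banach, second_countable_topology}"
  assumes "h \<in> borel_measurable leb"
  shows "integrable wleb h \<longleftrightarrow> integrable leb (\<lambda>x. omega x *\<^sub>R h x)"
  unfolding wleb_def using assms AE_omega_nonneg by (intro integrable_density) auto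

lemma wleb_integral:
  fixes h :: "real \<Rightarrow> 'a :: {banach, second_countable_topology}"
  assumes "h \<in> borel_measurable leb"
  shows "(LINT x|wleb. h x) = (LINT x|leb. omega x *\<^sub>R h x)"
  unfolding wleb_def using assms AE_omega_nonneg by (intro integral_density) auto

lemma H_norm_sq: "(H_norm f)\<^sup>2 = (LINT x|wleb. (cmod (f x))\<^sup>2)"
  unfolding H_norm_def by (subst real_sqrt_pow2) (auto intro: Bochner_Integration.integral_nonneg)

lemma H_norm_nonneg: "0 \<le> H_norm f"
  by (simp add: H_norm_def)

lemma borel_measurable_cnj [measurable (raw)]:
  "f \<in> borel_measurable M \<Longrightarrow> (\<lambda>x. cnj (f x)) \<in> borel_measurable M"
  by (rule measurable_compose[OF _ borel_measurable_continuous_onI]) (auto intro: continuous_intros)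

lemma square_integrable_combination:
  fixes f g :: "'a \<Rightarrow> complex"
  assumes [measurable]: "f \<in> borel_measurable M" "g \<in> borel_measurable M"
    and f: "integrable M (\<lambda>x. (cmod (f x))\<^sup>2)" and g: "integrable M (\<lambda>x. (cmod (g x))\<^sup>2)"
  shows "integrable M (\<lambda>x. (cmod (f x + c * g x))\<^sup>2)"
proof (rule Bochner_Integration.integrable_bound)
  show "integrable M (\<lambda>x. 2 * (cmod (f x))\<^sup>2 + 2 * ((cmod c)\<^sup>2 * (cmod (g x))\<^sup>2))"
    using f g by (intro Bochner_Integration.integrable_add integrable_mult_right)
  show "AE x in M. norm ((cmod (f x + c * g x))\<^sup>2) \<le> norm (2 * (cmod (f x))\<^sup>2 + 2 * ((cmod c)\<^sup>2 * (cmod (g x))\<^sup>2))"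
  proof (rule AE_I2)
    fix x
    have "(cmod (f x + c * g x))\<^sup>2 \<le> (cmod (f x) + cmod (c * g x))\<^sup>2"
      by (intro power_mono norm_triangle_ineq) auto
    also have "\<dots> \<le> 2 * (cmod (f x))\<^sup>2 + 2 * (cmod (c * g x))\<^sup>2"
      using zero_le_power2[of "cmod (f x) - cmod (c * g x)"] by (simp add: power2_sum power2_diff)
    finally show "norm ((cmod (f x + c * g x))\<^sup>2) \<le> norm (2 * (cmod (f x))\<^sup>2 + 2 * ((cmod c)\<^sup>2 * (cmod (g x))\<^sup>2))"
      by (simp add: norm_mult power_mult_distrib)
  qed
qed measurable

lemma square_integrable_mult_cnj:
  fixes f g :: "'a \<Rightarrow> complex"
  assumes [measurable]: "f \<in> borel_measurable M" "g \<in> borel_measurable M"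
    and f: "integrable M (\<lambda>x. (cmod (f x))\<^sup>2)" and g: "integrable M (\<lambda>x. (cmod (g x))\<^sup>2)"
  shows "integrable M (\<lambda>x. f x * cnj (g x))"
proof (rule Bochner_Integration.integrable_bound)
  show "integrable M (\<lambda>x. (cmod (f x))\<^sup>2 + (cmod (g x))\<^sup>2)"
    using f g by (rule Bochner_Integration.integrable_add)
  show "AE x in M. norm (f x * cnj (g x)) \<le> norm ((cmod (f x))\<^sup>2 + (cmod (g x))\<^sup>2)"
  proof (rule AE_I2)
    fix x
    have "cmod (f x) * cmod (g x) \<le> (cmod (f x))\<^sup>2 + (cmod (g x))\<^sup>2"
      using zero_le_power2[of "cmod (f x) - cmod (g x)"] 
        mult_nonneg_nonneg[OF norm_ge_zero norm_ge_zero, of "f x" "g x"] unfolding power2_diff by linarith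
    then show "norm (f x * cnj (g x)) \<le> norm ((cmod (f x))\<^sup>2 + (cmod (g x))\<^sup>2)"
      by (simp add: norm_mult)
  qed
qed measurable

lemma H_spaceD:
  assumes "f \<in> H_space"
  shows "f \<in> borel_measurable wleb" "integrable wleb (\<lambda>x. (cmod (f x))\<^sup>2)"
  using assms by (auto simp: H_space_def)

lemma H_space_combination:
  "f \<in> H_space \<Longrightarrow> g \<in> H_space \<Longrightarrow> (\<lambda>x. f x + c * g x) \<in> H_space"
  using square_integrable_combination[of f wleb g c] by (auto simp: H_space_def)

lemma H_inner_integrable:
  "f \<in> H_space \<Longrightarrow> g \<in> H_space \<Longrightarrow> integrable wleb (\<lambda>x. f x * cnj (g x))"
  using square_integrable_mult_cnj[of f wleb g] by (simp add: H_space_def)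

lemma H_inner_combination:
  assumes "f \<in> H_space" "g \<in> H_space" "k \<in> H_space"
  shows "H_inner (\<lambda>x. f x + c * g x) k = H_inner f k + c * H_inner g k"
  using H_inner_integrable[OF assms(1,3)] H_inner_integrable[OF assms(2,3)]
  by (simp add: H_inner_def distrib_right mult.assoc)

lemma H_inner_commute: "H_inner g f = cnj (H_inner f g)"
  unfolding H_inner_def by (subst Bochner_Integration.integral_cnj[symmetric]) (simp add: mult.commute)

lemma H_inner_self: "H_inner f f = of_real ((H_norm f)\<^sup>2)"
  unfolding H_inner_def H_norm_sq by (simp flip: complex_norm_square integral_complex_of_real)

lemma H_inner_cong_AE:
  assumes "f \<in> borel_measurable wleb" "f' \<in> borel_measurable wleb"
    "g \<in> borel_measurable wleb" "g' \<in> borel_measurable wleb"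
    "AE x in wleb. f x = f' x" "AE x in wleb. g x = g' x"
  shows "H_inner f g = H_inner f' g'"
  unfolding H_inner_def
proof (rule integral_cong_AE)
  show "AE x in wleb. f x * cnj (g x) = f' x * cnj (g' x)"
    using assms(5,6) by eventually_elim simp
qed (use assms in measurable)

lemma AE_wleb: "AE x in leb. P x \<Longrightarrow> AE x in wleb. P x"
  unfolding wleb_def by (subst AE_density) auto

lemma Re_H_inner_le:
  assumes f: "f \<in> H_space" and g: "g \<in> H_space" and s: "0 < s"
  shows "Re (H_inner f g) \<le> s / 2 * (H_norm f)\<^sup>2 + 1 / (2 * s) * (H_norm g)\<^sup>2"
proof -
  note i = H_inner_integrable[OF f g] H_spaceD(2)[OF f] H_spaceD(2)[OF g]
  have "Re (H_inner f g) = (LINT x|wleb. Re (f x * cnj (g x)))"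
    unfolding H_inner_def using i(1) by (simp only: integral_Re)
  also have "\<dots> \<le> (LINT x|wleb. s / 2 * (cmod (f x))\<^sup>2 + 1 / (2 * s) * (cmod (g x))\<^sup>2)"
  proof (rule integral_mono)
    fix x
    have "Re (f x * cnj (g x)) \<le> cmod (f x) * cmod (g x)"
      using complex_Re_le_cmod[of "f x * cnj (g x)"] by (simp add: norm_mult)
    also have "\<dots> \<le> s / 2 * (cmod (f x))\<^sup>2 + 1 / (2 * s) * (cmod (g x))\<^sup>2"
    proof -
      have "0 \<le> (s * cmod (f x) - cmod (g x))\<^sup>2 / (2 * s)" using s by simp
      also have "\<dots> = s / 2 * (cmod (f x))\<^sup>2 + 1 / (2 * s) * (cmod (g x))\<^sup>2 - cmod (f x) * cmod (g x)"
        using s by (simp add: power2_eq_square field_simps)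
      finally show ?thesis by simp
    qed
    finally show "Re (f x * cnj (g x)) \<le> s / 2 * (cmod (f x))\<^sup>2 + 1 / (2 * s) * (cmod (g x))\<^sup>2" .
  qed (intro integrable_Re i Bochner_Integration.integrable_add integrable_mult_right)+
  also have "\<dots> = s / 2 * (H_norm f)\<^sup>2 + 1 / (2 * s) * (H_norm g)\<^sup>2"
    using i by (simp add: H_norm_sq)
  finally show ?thesis .
qed

section \<open>The form domain\<close>

lemma L2_loc_combination:
  assumes f: "f \<in> L2_loc" and g: "g \<in> L2_loc"
  shows "(\<lambda>x. f x + c * g x) \<in> L2_loc"
proof -
  have m[measurable]: "f \<in> borel_measurable leb" "g \<in> borel_measurable leb" using f g by (auto simp: L2_loc_def)
  have "set_integrable leb K (\<lambda>x. (cmod (f x + c * g x))\<^sup>2)" if K: "compact K" "K \<subseteq> {0<..<pi}" for K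
  proof -
    have KM[measurable]: "K \<in> sets leb"
      using K borel_compact[of K] by (auto simp: sets_leb sets_restrict_space_iff)
    have ind: "(cmod (indicator K x *\<^sub>R h x))\<^sup>2 = indicator K x *\<^sub>R (cmod (h x))\<^sup>2" for x and h :: "real \<Rightarrow> complex"
      by (simp add: indicator_def)
    have "set_integrable leb K (\<lambda>x. (cmod (f x))\<^sup>2)" "set_integrable leb K (\<lambda>x. (cmod (g x))\<^sup>2)"
      using f g K by (auto simp: L2_loc_def)
    then have "integrable leb (\<lambda>x. (cmod (indicator K x *\<^sub>R f x))\<^sup>2)" "integrable leb (\<lambda>x. (cmod (indicator K x *\<^sub>R g x))\<^sup>2)"
      unfolding set_integrable_def by (simp_all only: ind)
    moreover have "(\<lambda>x. indicator K x *\<^sub>R f x) \<in> borel_measurable leb" "(\<lambda>x. indicator K x *\<^sub>R g x) \<in> borel_measurable leb"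
      using KM by measurable
    ultimately have "integrable leb (\<lambda>x. (cmod (indicator K x *\<^sub>R f x + c * (indicator K x *\<^sub>R g x)))\<^sup>2)"
      by (intro square_integrable_combination)
    moreover have "(cmod (indicator K x *\<^sub>R f x + c * (indicator K x *\<^sub>R g x)))\<^sup>2 = indicator K x *\<^sub>R (cmod (f x + c * g x))\<^sup>2" for x
      by (simp add: indicator_def)
    ultimately show ?thesis unfolding set_integrable_def by (simp only:)
  qed
  then show ?thesis by (simp add: L2_loc_def)
qed

lemma is_weak_deriv_combination:
  assumes "f \<in> L2_loc" "g \<in> L2_loc" "f' \<in> L2_loc" "g' \<in> L2_loc"
    and "is_weak_deriv f f'" "is_weak_deriv g g'"
  shows "is_weak_deriv (\<lambda>x. f x + c * g x) (\<lambda>x. f' x + c * g' x)"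
  unfolding is_weak_deriv_def
proof
  fix \<psi> assume \<psi>: "\<psi> \<in> test_functions"
  have lin: "(LINT x|leb. (h x + c * k x) * of_real (\<phi> x))
      = (LINT x|leb. h x * of_real (\<phi> x)) + c * (LINT x|leb. k x * of_real (\<phi> x))"
    if "h \<in> L2_loc" "k \<in> L2_loc" "\<phi> \<in> test_functions" for h k \<phi>
    using integrable_mult_test_function[OF L2_loc_imp_locally_integrable that(3)] that
    by (simp add: distrib_right mult.assoc)
  show "(LINT x|leb. (f x + c * g x) * of_real (deriv \<psi> x)) = - (LINT x|leb. (f' x + c * g' x) * of_real (\<psi> x))"
    using assms \<psi> deriv_test_function[OF \<psi>] by (simp add: lin is_weak_deriv_def)
qed

lemma H1_loc_combination:
  assumes f: "f \<in> H1_loc" and g: "g \<in> H1_loc"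
  shows "(\<lambda>x. f x + c * g x) \<in> H1_loc"
    and "AE x in leb. weak_deriv (\<lambda>x. f x + c * g x) x = weak_deriv f x + c * weak_deriv g x"
    and "x \<in> {0<..<pi} \<Longrightarrow> cont_rep (\<lambda>x. f x + c * g x) x = cont_rep f x + c * cont_rep g x"
proof -
  have fg: "f \<in> L2_loc" "g \<in> L2_loc" using f g by (auto simp: H1_loc_def)
  have d: "(\<lambda>x. weak_deriv f x + c * weak_deriv g x) \<in> L2_loc"
    "is_weak_deriv (\<lambda>x. f x + c * g x) (\<lambda>x. weak_deriv f x + c * weak_deriv g x)"
    using fg weak_derivD[OF f] weak_derivD[OF g] L2_loc_combination is_weak_deriv_combination by auto
  then show H: "(\<lambda>x. f x + c * g x) \<in> H1_loc"
    using L2_loc_combination[OF fg] by (auto simp: H1_loc_def)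
  show "AE x in leb. weak_deriv (\<lambda>x. f x + c * g x) x = weak_deriv f x + c * weak_deriv g x"
    by (rule weak_deriv_unique[OF weak_derivD[OF H] d])
  show "cont_rep (\<lambda>x. f x + c * g x) x = cont_rep f x + c * cont_rep g x" if "x \<in> {0<..<pi}"
  proof (rule cont_rep_eqI[OF H _ _ that])
    show "continuous_on {0<..<pi} (\<lambda>x. cont_rep f x + c * cont_rep g x)"
      by (intro continuous_intros cont_rep f g)
    show "AE x in leb. cont_rep f x + c * cont_rep g x = f x + c * g x"
      using cont_rep(2)[OF f] cont_rep(2)[OF g] by eventually_elim simp
  qed
qed

lemma form_domD:
  assumes "f \<in> form_dom"
  shows "f \<in> H_space" "f \<in> H1_loc" "weak_deriv f \<in> H_space"
proof -
  show "f \<in> H_space" and H: "f \<in> H1_loc" using assms by (auto simp: form_dom_def)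
  have m[measurable]: "weak_deriv f \<in> borel_measurable leb"
    using weak_derivD(1)[OF H] by (simp add: L2_loc_def)
  show "weak_deriv f \<in> H_space"
    using assms unfolding form_dom_def H_space_def measurable_wleb by (simp add: wleb_integrable m)
qed

text \<open>
  Membership can be checked on any function that agrees almost everywhere with the weak
  derivative.
\<close>

lemma form_domI:
  assumes "f \<in> H_space" "f \<in> H1_loc" "g \<in> H_space" "AE x in leb. weak_deriv f x = g x"
  shows "f \<in> form_dom"
proof -
  have m[measurable]: "weak_deriv f \<in> borel_measurable leb" "g \<in> borel_measurable leb"
    using weak_derivD(1)[OF assms(2)] assms(3) by (auto simp: L2_loc_def H_space_def measurable_wleb)
  have "integrable leb (\<lambda>x. omega x * (cmod (g x))\<^sup>2)"
    using assms(3) unfolding H_space_def by (simp add: wleb_integrable)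
  moreover have "AE x in leb. omega x * (cmod (g x))\<^sup>2 = omega x * (cmod (weak_deriv f x))\<^sup>2"
    using assms(4) by eventually_elim simp
  ultimately have "integrable leb (\<lambda>x. omega x * (cmod (weak_deriv f x))\<^sup>2)"
    by (subst (asm) integrable_cong_AE) auto
  with assms show ?thesis by (simp add: form_dom_def)
qed

lemma form_dom_combination:
  assumes "f \<in> form_dom" "g \<in> form_dom"
  shows "(\<lambda>x. f x + c * g x) \<in> form_dom"
proof (rule form_domI)
  show "(\<lambda>x. f x + c * g x) \<in> H_space"
    by (rule H_space_combination[OF assms[THEN form_domD(1)]])
  show "(\<lambda>x. weak_deriv f x + c * weak_deriv g x) \<in> H_space"
    by (rule H_space_combination[OF assms[THEN form_domD(3)]])
qed (fact H1_loc_combination(1,2)[OF assms[THEN form_domD(2)]])+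

text \<open>
  With this identity, sesquilinearity and Hermitian symmetry of the form follow from those of the
  inner product.
\<close>

lemma form0_eq_H_inner:
  assumes "f \<in> form_dom" "g \<in> form_dom"
  shows "form0 f g = 4 * H_inner (weak_deriv f) (weak_deriv g)"
proof -
  have [measurable]: "weak_deriv f \<in> borel_measurable leb" "weak_deriv g \<in> borel_measurable leb"
    using assms[THEN form_domD(3)] by (auto simp: H_space_def measurable_wleb)
  show ?thesis unfolding form0_def H_inner_def
    by (subst wleb_integral) (auto simp: scaleR_conv_of_real mult.assoc)
qed

lemma energy_eq: "f \<in> form_dom \<Longrightarrow>
  (LINT t|leb. omega t * (cmod (weak_deriv f t))\<^sup>2) = (H_norm (weak_deriv f))\<^sup>2"
  using form_domD(3)[of f] unfolding H_norm_sq H_space_def measurable_wleb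
  by (subst wleb_integral) auto

section \<open>Endpoint values and the lower bound\<close>

lemma set_integral_mono_domain:
  fixes f :: "'a \<Rightarrow> real"
  assumes "set_integrable M B f" "set_integrable M A f" "A \<subseteq> B" "\<And>x. x \<in> B \<Longrightarrow> 0 \<le> f x"
  shows "(LINT x:A|M. f x) \<le> (LINT x:B|M. f x)"
  using assms unfolding set_integrable_def set_lebesgue_integral_def
  by (intro integral_mono) (auto simp: indicator_def)

text \<open>
  A crude linear lower bound is enough, as constants are immaterial in what follows. Up to
  \<open>\<pi> / 3\<close> the difference is increasing; beyond, \<open>sin t \<ge> \<surd>3 / 2\<close> already exceeds \<open>\<pi> / 4\<close>.
\<close>

lemma half_le_sin:
  assumes "0 \<le> t" "t \<le> pi / 2" shows "t / 2 \<le> sin t"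
proof (cases "t \<le> pi / 3")
  case True
  have "sin 0 - 0 / 2 \<le> sin t - t / 2"
  proof (rule DERIV_nonneg_imp_nondecreasing[OF assms(1)])
    fix x assume x: "0 \<le> x" "x \<le> t"
    have "cos (pi / 3) \<le> cos x" using x True by (intro cos_monotone_0_pi_le) auto
    then show "\<exists>y. ((\<lambda>t. sin t - t / 2) has_real_derivative y) (at x) \<and> 0 \<le> y"
      by (intro exI[of _ "cos x - 1 / 2"]) (auto intro!: derivative_eq_intros simp: cos_60)
  qed
  then show ?thesis by simp
next
  case False
  have "t / 2 \<le> 85 / 100 " using assms pi_approx by simp
  also have "85 / 100 \<le> sqrt 3 / 2" using real_le_rsqrt[of "17 / 10" 3] by (simp add: power2_eq_square)
  also have "\<dots> = sin (pi / 3)" by (simp add: sin_60)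
  also have "\<dots> \<le> sin t" using assms False by (intro sin_monotone_2pi_le) auto
  finally show ?thesis .
qed

lemma sqrt_half_le_omega: "0 \<le> t \<Longrightarrow> t \<le> pi / 2 \<Longrightarrow> sqrt t / 2 \<le> omega t"
proof -
  assume t: "0 \<le> t" "t \<le> pi / 2"
  have "sqrt t / 2 = sqrt (t / 4)" by (simp add: real_sqrt_divide)
  also have "\<dots> \<le> sqrt (sin t)" using half_le_sin[OF t] t by (intro real_sqrt_le_mono) linarith
  finally show ?thesis by (simp add: omega_def)
qed

text \<open>
  The choice \<open>s = D / A\<close> gives the claim; for \<open>A = 0\<close> the bound forces \<open>D = 0\<close>, by letting \<open>s\<close> be
  large.
\<close>

lemma square_le_product_of_weighted_bounds:
  fixes A B D :: real
  assumes "0 \<le> A" "0 \<le> B" "0 \<le> D" and *: "\<And>s. 0 < s \<Longrightarrow> 2 * D \<le> s * A + B / s"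
  shows "D\<^sup>2 \<le> A * B"
proof (cases "D = 0")
  case False
  then have D: "0 < D" using assms by simp
  show ?thesis
  proof (cases "A = 0")
    case True
    have "2 * D \<le> B / ((1 + B) / D)" using *[of "(1 + B) / D"] True D assms(2) by simp
    also have "\<dots> = D * (B / (1 + B))" by simp
    also have "\<dots> \<le> D * 1" using D assms(2) by (intro mult_left_mono) (auto simp: divide_le_eq)
    finally show ?thesis using D by simp
  next
    case False
    then have A: "0 < A" using assms by simp
    have "2 * D \<le> D / A * A + B / (D / A)" using A D by (intro *) simp
    then have "D \<le> B * A / D" using A by simp
    then show ?thesis using D by (simp add: field_simps power2_eq_square)
  qed
qed (use assms in simp)

text \<open>
  Cauchy--Schwarz for \<open>\<integral> g\<close>, with weights \<open>\<omega>\<close> and \<open>1 / \<omega>\<close>, obtained by optimising \<open>s\<close> in the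
  pointwise inequality \<open>2 |g| \<le> s \<omega> |g|\<^sup>2 + 1 / (s \<omega>)\<close>. The integral of \<open>1 / \<omega>\<close> enters through a
  majorant \<open>p\<close> with an explicit primitive \<open>P\<close>, so that one statement serves both endpoints.
\<close>

lemma energy_increment:
  assumes f: "f \<in> form_dom" and xy: "0 < x" "x \<le> y" "y < pi"
    and P: "\<And>t. t \<in> {x..y} \<Longrightarrow> (P has_real_derivative p t) (at t)"
    and p: "\<And>t. t \<in> {x..y} \<Longrightarrow> 1 / omega t \<le> p t"
  shows "(cmod (cont_rep f y - cont_rep f x))\<^sup>2
    \<le> (LINT t|leb. omega t * (cmod (weak_deriv f t))\<^sup>2) * (P y - P x)"
proof -
  define g where "g = weak_deriv f"
  define A where "A = (LINT t|leb. omega t * (cmod (g t))\<^sup>2)"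
  have f1: "f \<in> H1_loc" using f by (simp add: form_dom_def)
  have g: "locally_integrable g"
    unfolding g_def using weak_derivD(1)[OF f1] by (rule L2_loc_imp_locally_integrable)
  have Ai: "set_integrable lborel {0<..<pi} (\<lambda>t. omega t * (cmod (g t))\<^sup>2)"
    using f unfolding form_dom_def leb_integrable g_def by simp
  have sub: "set_integrable lborel {x..y} (\<lambda>t. omega t * (cmod (g t))\<^sup>2)"
    using xy by (intro set_integrable_subset[OF Ai]) auto
  have gi: "g integrable_on {x..y}"
    using xy by (intro set_borel_integral_eq_integral locally_integrableD[OF g])
  note wi = set_borel_integral_eq_integral[OF sub]
  have pi_: "(p has_integral (P y - P x)) {x..y}"
    using xy has_field_derivative_at_within[OF P]
    by (intro fundamental_theorem_of_calculus) (auto simp flip: has_real_derivative_iff_has_vector_derivative)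
  have "0 \<le> p t" if "t \<in> {x..y}" for t
    using p[OF that] omega_pos[of t] that xy by (intro order_trans[OF _ p[OF that]]) auto
  then have "0 \<le> P y - P x" by (rule has_integral_nonneg[OF pi_])
  have le_A: "integral {x..y} (\<lambda>t. omega t * (cmod (g t))\<^sup>2) \<le> A"
    unfolding A_def leb_integral wi(2)[symmetric]
    using xy by (intro set_integral_mono_domain Ai sub) (auto intro!: mult_nonneg_nonneg less_imp_le[OF omega_pos])
  have "0 \<le> A" unfolding A_def
    by (intro integral_nonneg_AE) (use AE_omega_nonneg in eventually_elim, auto)
  have "(cmod (integral {x..y} g))\<^sup>2 \<le> A * (P y - P x)"
  proof (rule square_le_product_of_weighted_bounds)
    fix s :: real assume s: "0 < s"
    have "cmod (integral {x..y} g) \<le> integral {x..y} (\<lambda>t. s / 2 * (omega t * (cmod (g t))\<^sup>2) + (1 / (2 * s)) * p t)"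
    proof (rule integral_norm_bound_integral[OF gi])
      show "(\<lambda>t. s / 2 * (omega t * (cmod (g t))\<^sup>2) + (1 / (2 * s)) * p t) integrable_on {x..y}"
        using wi(1) pi_ by (intro integrable_add integrable_on_mult_right) auto
      fix t assume t: "t \<in> {x..y}"
      then have o: "0 < omega t" using xy by (intro omega_pos) auto
      have "0 \<le> (s * omega t * cmod (g t) - 1)\<^sup>2 / (2 * s * omega t)"
        using s o by simp
      also have "\<dots> = s / 2 * (omega t * (cmod (g t))\<^sup>2) + (1 / (2 * s)) * (1 / omega t) - cmod (g t)"
        using s o by (simp add: power2_eq_square field_simps)
      finally have "cmod (g t) \<le> s / 2 * (omega t * (cmod (g t))\<^sup>2) + (1 / (2 * s)) * (1 / omega t)" by simp
      also have "\<dots> \<le> s / 2 * (omega t * (cmod (g t))\<^sup>2) + (1 / (2 * s)) * p t"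
        using s p[OF t] by (intro add_left_mono mult_left_mono) auto
      finally show "cmod (g t) \<le> \<dots>" .
    qed
    also have "\<dots> = s / 2 * integral {x..y} (\<lambda>t. omega t * (cmod (g t))\<^sup>2) + (1 / (2 * s)) * (P y - P x)"
      by (intro integral_unique has_integral_add has_integral_mult_right pi_ integrable_integral wi(1))
    also have "\<dots> \<le> s / 2 * A + (1 / (2 * s)) * (P y - P x)"
      using s le_A by (intro add_right_mono mult_left_mono) auto
    finally show "2 * cmod (integral {x..y} g) \<le> s * A + (P y - P x) / s" by simp
  qed (use \<open>0 \<le> A\<close> \<open>0 \<le> P y - P x\<close> in auto)
  then show ?thesis using cont_rep(3)[OF f1 xy] by (simp add: A_def g_def)
qed

text \<open>
  The increment bound makes \<open>v\<close> uniformly continuous near \<open>0\<close>, because \<open>\<surd>y - \<surd>x \<le> \<surd>(y - x)\<close>;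
  therefore it extends continuously to the endpoint.
\<close>

lemma trace_limit:
  fixes v :: "real \<Rightarrow> complex"
  assumes a: "0 \<le> a"
    and inc: "\<And>x y. 0 < x \<Longrightarrow> x \<le> y \<Longrightarrow> y \<le> pi / 2 \<Longrightarrow> (cmod (v y - v x))\<^sup>2 \<le> 4 * a * (sqrt y - sqrt x)"
  obtains L where "(v \<longlongrightarrow> L) (at_right 0)"
    "\<And>y. 0 < y \<Longrightarrow> y \<le> pi / 2 \<Longrightarrow> (cmod (v y - L))\<^sup>2 \<le> 4 * a * sqrt y"
proof -
  have "uniformly_continuous_on {0<..pi/2} v"
    unfolding uniformly_continuous_on_def
  proof (intro allI impI)
    fix e :: real assume e: "0 < e"
    define d where "d = (e\<^sup>2 / (4 * a + 1))\<^sup>2"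
    have d: "0 < d" using a e by (simp add: d_def add_nonneg_pos)
    have *: "dist (v y) (v x) < e" if "0 < x" "x \<le> y" "y \<le> pi / 2" "y - x < d" for x y
    proof -
      have "sqrt y \<le> sqrt x + sqrt (y - x)"
        using sqrt_add_le_add_sqrt[of x "y - x"] that by simp
      moreover have "sqrt (y - x) \<le> sqrt d" using that by simp
      moreover have "sqrt d = e\<^sup>2 / (4 * a + 1)" using a by (simp add: d_def real_sqrt_abs)
      ultimately have "sqrt y - sqrt x \<le> e\<^sup>2 / (4 * a + 1)" by linarith
      then have "4 * a * (sqrt y - sqrt x) \<le> 4 * a * (e\<^sup>2 / (4 * a + 1))"
        using a by (intro mult_left_mono) auto
      also have "\<dots> < e\<^sup>2" using a e by (simp add: divide_less_eq add_nonneg_pos algebra_simps)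
      finally have "(cmod (v y - v x))\<^sup>2 < e\<^sup>2" using inc[OF that(1-3)] by linarith
      then show ?thesis using e by (simp add: dist_norm power_less_imp_less_base)
    qed
    show "\<exists>d>0. \<forall>x\<in>{0<..pi / 2}. \<forall>x'\<in>{0<..pi / 2}. dist x' x < d \<longrightarrow> dist (v x') (v x) < e"
    proof (intro exI[of _ d] conjI d ballI impI)
      fix x x' assume x: "x \<in> {0<..pi/2}" "x' \<in> {0<..pi/2}" "dist x' x < d"
      show "dist (v x') (v x) < e"
      proof (cases "x \<le> x'")
        case True then show ?thesis using x by (intro *) (auto simp: dist_real_def)
      next
        case False then show ?thesis using x by (subst dist_commute, intro *) (auto simp: dist_real_def)
      qed
    qed
  qed
  moreover have "0 \<in> closure {0<..pi/2}" by simp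
  ultimately obtain L where "(v \<longlongrightarrow> L) (at 0 within {0<..pi/2})"
    using uniformly_continuous_on_extension_at_closure by blast
  moreover have "at 0 within {0<..pi/2} = at_right 0"
    by (rule at_within_nhd[of _ "{-1<..<1}"]) (use pi_gt3 in auto)
  ultimately have L: "(v \<longlongrightarrow> L) (at_right 0)" by simp
  have "(cmod (v y - L))\<^sup>2 \<le> 4 * a * sqrt y" if y: "0 < y" "y \<le> pi / 2" for y
  proof (rule tendsto_le[OF trivial_limit_at_right_real])
    show "((\<lambda>x. (cmod (v y - v x))\<^sup>2) \<longlongrightarrow> (cmod (v y - L))\<^sup>2) (at_right 0)"
      by (intro tendsto_intros L)
    have "((\<lambda>x. 4 * a * (sqrt y - sqrt x)) \<longlongrightarrow> 4 * a * (sqrt y - sqrt 0)) (at_right 0)"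
      by (intro tendsto_intros)
    then show "((\<lambda>x. 4 * a * (sqrt y - sqrt x)) \<longlongrightarrow> 4 * a * sqrt y) (at_right 0)" by simp
    have "eventually (\<lambda>x. x \<in> {0<..<y}) (at_right 0)" using y by (intro eventually_at_right_real)
    then show "eventually (\<lambda>x. (cmod (v y - v x))\<^sup>2 \<le> 4 * a * (sqrt y - sqrt x)) (at_right 0)"
      by eventually_elim (use y in \<open>auto intro!: inc\<close>)
  qed
  with L that show ?thesis by blast
qed

text \<open>
  Here the length scale enters. On the window \<open>[\<delta>\<^sup>2 / 4, \<delta>\<^sup>2]\<close>, of length of order \<open>\<delta>\<^sup>2\<close>, the
  weight is at least \<open>\<delta> / 4\<close>, so that the weighted measure of the window is at least of order
  \<open>\<delta>\<^sup>3\<close>, while \<open>|v - L|\<^sup>2\<close> is at most \<open>4 \<delta> a\<close> there. Averaging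
  \<open>|L|\<^sup>2 \<le> 2 |v y|\<^sup>2 + 2 |v y - L|\<^sup>2\<close> over the window gives the claim.
\<close>

lemma trace_inequality:
  fixes v :: "real \<Rightarrow> complex"
  assumes a: "0 \<le> a" and \<delta>: "0 < \<delta>" "\<delta> \<le> 1"
    and L: "\<And>y. 0 < y \<Longrightarrow> y \<le> pi / 2 \<Longrightarrow> (cmod (v y - L))\<^sup>2 \<le> 4 * a * sqrt y"
    and int: "integrable leb (\<lambda>t. omega t * (cmod (v t))\<^sup>2)"
  shows "(cmod L)\<^sup>2 \<le> 16 / \<delta> ^ 3 * (LINT t|leb. omega t * (cmod (v t))\<^sup>2) + 8 * \<delta> * a"
proof -
  define N where "N = (LINT t|leb. omega t * (cmod (v t))\<^sup>2)"
  \<comment> \<open>The part of \<open>|L|\<^sup>2\<close> that the increment bound does not account for.\<close>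
  define T where "T = (cmod L)\<^sup>2 - 8 * \<delta> * a"
  have i: "set_integrable lborel {0<..<pi} (\<lambda>t. omega t * (cmod (v t))\<^sup>2)" using int by (simp add: leb_integrable)
  have N: "0 \<le> N" unfolding N_def
    by (intro integral_nonneg_AE) (use AE_omega_nonneg in eventually_elim, auto)
  have \<delta>2: "\<delta>\<^sup>2 \<le> 1" using \<delta> by (simp add: power_le_one)
  have "T \<le> 16 / \<delta> ^ 3 * N"
  proof (cases "0 \<le> T")
    case False
    then show ?thesis using N \<delta> by (smt (verit) divide_nonneg_pos mult_nonneg_nonneg zero_less_power)
  next
    case True
    define S where "S = {\<delta>\<^sup>2/4..\<delta>\<^sup>2}"
    have S: "S \<subseteq> {0<..<pi}" using \<delta> \<delta>2 pi_gt3 by (auto simp: S_def) (smt (verit) zero_less_power half_gt_zero)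
    have low: "T * \<delta> / 8 \<le> omega y * (cmod (v y))\<^sup>2 " if y: "y \<in> S" for y
    proof -
      have y0: "0 < y" using y S by auto
      have y1: "y \<le> pi / 2" using y \<delta>2 pi_gt3 by (auto simp: S_def)
      have sy: "sqrt y \<le> \<delta>" using y \<delta> by (intro real_le_lsqrt) (auto simp: S_def)
      have "(cmod L)\<^sup>2 \<le> (cmod (v y) + cmod (v y - L))\<^sup>2"
        by (intro power_mono) (use norm_triangle_ineq4[of "v y" "v y - L"] in auto)
      also have "\<dots> \<le> 2 * (cmod (v y))\<^sup>2 + 2 * (cmod (v y - L))\<^sup>2"
        using zero_le_power2[of "cmod (v y) - cmod (v y - L)"] by (simp add: power2_sum power2_diff)
      also have "2 * (cmod (v y - L))\<^sup>2 \<le> 2 * (4 * a * sqrt y)" using L[OF y0 y1] by simp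
      also have "2 * (4 * a * sqrt y) \<le> 2 * (4 * a * \<delta>)" using sy a by (intro mult_left_mono) auto
      finally have T: "T \<le> 2 * (cmod (v y))\<^sup>2" by (simp add: T_def algebra_simps)
      have "\<delta> / 2 \<le> sqrt y"
        using y \<delta> by (intro real_le_rsqrt) (simp add: S_def power_divide)
      then have "\<delta> / 4 \<le> omega y" using sqrt_half_le_omega[of y] y0 y1 by simp
      then have "(\<delta> / 4) * (T / 2) \<le> omega y * (cmod (v y))\<^sup>2"
        using T True \<delta> by (intro mult_mono) auto
      then show ?thesis by (simp add: algebra_simps)
    qed
    have Si: "set_integrable lborel S (\<lambda>t. omega t * (cmod (v t))\<^sup>2)"
      using S by (intro set_integrable_subset[OF i]) (auto simp: S_def)
    have "T * \<delta> / 8 * (3 / 4 * \<delta>\<^sup>2) = (LINT y:S|lborel. T * \<delta> / 8)"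
      using \<delta> by (simp add: S_def set_lebesgue_integral_def)
    also have "\<dots> \<le> (LINT y:S|lborel. omega y * (cmod (v y))\<^sup>2)"
      by (intro set_integral_mono Si low) (auto simp: S_def intro!: borel_integrable_atLeastAtMost')
    also have "\<dots> \<le> N" unfolding N_def leb_integral
      by (intro set_integral_mono_domain i Si) (use S in \<open>auto simp: S_def intro!: mult_nonneg_nonneg less_imp_le[OF omega_pos]\<close>)
    finally have "T * \<delta> ^ 3 * 3 \<le> 32 * N" by (simp add: power2_eq_square power3_eq_cube)
    then have "T * \<delta> ^ 3 \<le> 16 * N" using N by linarith
    then show ?thesis using \<delta> by (simp add: field_simps)
  qed
  then show ?thesis by (simp add: T_def N_def)
qed

lemma energy_increment_left:
  assumes f: "f \<in> form_dom" and xy: "0 < x" "x \<le> y" "y \<le> pi / 2"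
  shows "(cmod (cont_rep f y - cont_rep f x))\<^sup>2 \<le> 4 * (H_norm (weak_deriv f))\<^sup>2 * (sqrt y - sqrt x)"
proof -
  have y: "y < pi" using xy pi_gt_zero by linarith
  have "(cmod (cont_rep f y - cont_rep f x))\<^sup>2
    \<le> (LINT t|leb. omega t * (cmod (weak_deriv f t))\<^sup>2) * (4 * sqrt y - 4 * sqrt x)"
  proof (rule energy_increment[OF f xy(1,2) y])
    fix t assume t: "t \<in> {x..y}"
    then have "0 < t" "t \<le> pi / 2" using xy by auto
    then show "((\<lambda>t. 4 * sqrt t) has_real_derivative 2 / sqrt t) (at t)"
      by (auto intro!: derivative_eq_intros simp: field_simps)
    show "1 / omega t \<le> 2 / sqrt t"
      using sqrt_half_le_omega[of t] omega_pos[of t] \<open>0 < t\<close> \<open>t \<le> pi / 2\<close> by (simp add: field_simps)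
  qed
  then show ?thesis using energy_eq[OF f] by (simp add: algebra_simps)
qed

lemma omega_reflect: "omega (pi - t) = omega t"
  by (simp add: omega_def)

text \<open>
  The reflection \<open>t \<mapsto> \<pi> - t\<close> preserves the weight, and the increment bound at \<open>\<pi>\<close> takes the same
  form as at \<open>0\<close> in the reflected variable.
\<close>

lemma energy_increment_right:
  assumes f: "f \<in> form_dom" and xy: "0 < x" "x \<le> y" "y \<le> pi / 2"
  shows "(cmod (cont_rep f (pi - y) - cont_rep f (pi - x)))\<^sup>2 \<le> 4 * (H_norm (weak_deriv f))\<^sup>2 * (sqrt y - sqrt x)"
proof -
  have y: "0 < pi - y" using xy pi_gt_zero by linarith
  have "(cmod (cont_rep f (pi - x) - cont_rep f (pi - y)))\<^sup>2
    \<le> (LINT t|leb. omega t * (cmod (weak_deriv f t))\<^sup>2) * (- 4 * sqrt (pi - (pi - x)) - - 4 * sqrt (pi - (pi - y)))"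
  proof (rule energy_increment[OF f y])
    fix t assume t: "t \<in> {pi - y..pi - x}"
    then have t': "0 < pi - t" "pi - t \<le> pi / 2" using xy by auto
    then show "((\<lambda>t. - 4 * sqrt (pi - t)) has_real_derivative 2 / sqrt (pi - t)) (at t)"
      by (auto intro!: derivative_eq_intros simp: field_simps)
    show "1 / omega t \<le> 2 / sqrt (pi - t)"
      using sqrt_half_le_omega[of "pi - t"] omega_pos[of "pi - t"] t' by (simp add: field_simps omega_reflect)
  qed (use xy in auto)
  then show ?thesis using energy_eq[OF f] by (simp add: algebra_simps norm_minus_commute)
qed

lemma value_0_limit:
  assumes f: "f \<in> form_dom"
  shows "(cont_rep f \<longlongrightarrow> value_0 f) (at_right 0)"
    and "0 < y \<Longrightarrow> y \<le> pi / 2 \<Longrightarrow> (cmod (cont_rep f y - value_0 f))\<^sup>2 \<le> 4 * (H_norm (weak_deriv f))\<^sup>2 * sqrt y"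
proof -
  obtain L where L: "(cont_rep f \<longlongrightarrow> L) (at_right 0)"
    "\<And>y. 0 < y \<Longrightarrow> y \<le> pi / 2 \<Longrightarrow> (cmod (cont_rep f y - L))\<^sup>2 \<le> 4 * (H_norm (weak_deriv f))\<^sup>2 * sqrt y"
    using trace_limit[OF zero_le_power2 energy_increment_left[OF f]] by metis
  moreover have "value_0 f = L"
    unfolding value_0_def by (rule tendsto_Lim[OF trivial_limit_at_right_real L(1)])
  ultimately show "(cont_rep f \<longlongrightarrow> value_0 f) (at_right 0)"
    "0 < y \<Longrightarrow> y \<le> pi / 2 \<Longrightarrow> (cmod (cont_rep f y - value_0 f))\<^sup>2 \<le> 4 * (H_norm (weak_deriv f))\<^sup>2 * sqrt y"
    by auto
qed

lemma value_pi_limit: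
  assumes f: "f \<in> form_dom"
  shows "(cont_rep f \<longlongrightarrow> value_pi f) (at_left pi)"
    and "0 < y \<Longrightarrow> y \<le> pi / 2 \<Longrightarrow> (cmod (cont_rep f (pi - y) - value_pi f))\<^sup>2 \<le> 4 * (H_norm (weak_deriv f))\<^sup>2 * sqrt y"
proof -
  obtain L where L: "((\<lambda>t. cont_rep f (pi - t)) \<longlongrightarrow> L) (at_right 0)"
    "\<And>y. 0 < y \<Longrightarrow> y \<le> pi / 2 \<Longrightarrow> (cmod (cont_rep f (pi - y) - L))\<^sup>2 \<le> 4 * (H_norm (weak_deriv f))\<^sup>2 * sqrt y"
    using trace_limit[where v = "\<lambda>t. cont_rep f (pi - t)", OF zero_le_power2 energy_increment_right[OF f]] by metis
  have "filterlim (\<lambda>t. pi - t) (at_right 0) (at_left pi)"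
    unfolding filterlim_at
  proof (intro conjI)
    have "((\<lambda>t. pi - t) \<longlongrightarrow> pi - pi) (at_left pi)" by (intro tendsto_intros)
    then show "((\<lambda>t. pi - t) \<longlongrightarrow> 0) (at_left pi)" by simp
    show "\<forall>\<^sub>F t in at_left pi. pi - t \<in> {0<..} \<and> pi - t \<noteq> 0"
      by (auto simp: eventually_at_filter)
  qed
  from filterlim_compose[OF L(1) this] have L': "(cont_rep f \<longlongrightarrow> L) (at_left pi)" by simp
  moreover have "value_pi f = L"
    unfolding value_pi_def by (rule tendsto_Lim[OF trivial_limit_at_left_real L'])
  ultimately show "(cont_rep f \<longlongrightarrow> value_pi f) (at_left pi)"
    "0 < y \<Longrightarrow> y \<le> pi / 2 \<Longrightarrow> (cmod (cont_rep f (pi - y) - value_pi f))\<^sup>2 \<le> 4 * (H_norm (weak_deriv f))\<^sup>2 * sqrt y"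
    using L(2) by auto
qed

lemma endpoint_values_combination:
  assumes f: "f \<in> form_dom" and g: "g \<in> form_dom"
  shows "value_0 (\<lambda>x. f x + c * g x) = value_0 f + c * value_0 g"
    and "value_pi (\<lambda>x. f x + c * g x) = value_pi f + c * value_pi g"
proof -
  note h = form_dom_combination[OF f g, of c]
  note eq = H1_loc_combination(3)[OF form_domD(2)[OF f] form_domD(2)[OF g], of _ c]
  have "eventually (\<lambda>x. x \<in> {0<..<pi}) (at_right 0)"
    by (intro eventually_at_right_real) simp
  then have ev: "eventually (\<lambda>x. cont_rep f x + c * cont_rep g x = cont_rep (\<lambda>x. f x + c * g x) x) (at_right 0)"
    by eventually_elim (simp add: eq)
  have "((\<lambda>x. cont_rep f x + c * cont_rep g x) \<longlongrightarrow> value_0 f + c * value_0 g) (at_right 0)"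
    by (intro tendsto_intros value_0_limit f g)
  from Lim_transform_eventually[OF this ev] value_0_limit(1)[OF h]
  show "value_0 (\<lambda>x. f x + c * g x) = value_0 f + c * value_0 g"
    using tendsto_unique[OF trivial_limit_at_right_real] by blast
  have "eventually (\<lambda>x. x \<in> {0<..<pi}) (at_left pi)"
    by (intro eventually_at_left_real) simp
  then have ev: "eventually (\<lambda>x. cont_rep f x + c * cont_rep g x = cont_rep (\<lambda>x. f x + c * g x) x) (at_left pi)"
    by eventually_elim (simp add: eq)
  have "((\<lambda>x. cont_rep f x + c * cont_rep g x) \<longlongrightarrow> value_pi f + c * value_pi g) (at_left pi)"
    by (intro tendsto_intros value_pi_limit f g)
  from Lim_transform_eventually[OF this ev] value_pi_limit(1)[OF h]
  show "value_pi (\<lambda>x. f x + c * g x) = value_pi f + c * value_pi g"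
    using tendsto_unique[OF trivial_limit_at_left_real] by blast
qed

text \<open>
  The trace inequality concerns the continuous representative; its weighted norm is that of \<open>f\<close>,
  and for the endpoint \<open>\<pi>\<close> it is invariant under the reflection.
\<close>

lemma endpoint_trace_inequality:
  assumes f: "f \<in> form_dom" and \<delta>: "0 < \<delta>" "\<delta> \<le> 1"
  shows "(cmod (value_0 f))\<^sup>2 \<le> 16 / \<delta> ^ 3 * (H_norm f)\<^sup>2 + 8 * \<delta> * (H_norm (weak_deriv f))\<^sup>2"
    and "(cmod (value_pi f))\<^sup>2 \<le> 16 / \<delta> ^ 3 * (H_norm f)\<^sup>2 + 8 * \<delta> * (H_norm (weak_deriv f))\<^sup>2"
proof -
  have [measurable]: "f \<in> borel_measurable leb"
    using form_domD(1)[OF f] by (simp add: H_space_def measurable_wleb)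
  note c = cont_rep(1,2)[OF form_domD(2)[OF f]]
  define w where "w t = omega t * (cmod (cont_rep f t))\<^sup>2" for t
  have om: "continuous_on {0<..<pi} w"
    unfolding w_def omega_def by (intro continuous_intros c)
  have wm[measurable]: "w \<in> borel_measurable leb"
    unfolding measurable_leb_iff using borel_measurable_continuous_on_indicator[OF _ om] by simp
  have AE: "AE t in leb. w t = omega t * (cmod (f t))\<^sup>2"
    using c(2) by eventually_elim (simp add: w_def)
  have "integrable leb (\<lambda>t. omega t * (cmod (f t))\<^sup>2)"
    using H_spaceD(2)[OF form_domD(1)[OF f]] by (simp add: wleb_integrable)
  then have wi: "integrable leb w" using AE by (subst integrable_cong_AE) auto
  have "(LINT t|leb. w t) = (LINT t|leb. omega t * (cmod (f t))\<^sup>2)"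
    using AE by (intro integral_cong_AE) auto
  also have "\<dots> = (H_norm f)\<^sup>2" unfolding H_norm_sq by (subst wleb_integral) auto
  finally have wN: "(LINT t|leb. w t) = (H_norm f)\<^sup>2" .
  have ind: "indicator {0<..<pi} (pi + - 1 * t) = (indicator {0<..<pi} t :: real)" for t
    by (auto simp: indicator_def)
  have ri: "integrable leb (\<lambda>t. w (pi - t))"
    using wi unfolding leb_integrable set_integrable_def
    by (subst (asm) lborel_integrable_real_affine_iff[of "-1" _ pi, symmetric]) (simp_all add: ind[simplified])
  have rN: "(LINT t|leb. w (pi - t)) = (H_norm f)\<^sup>2"
    using wN unfolding leb_integral set_lebesgue_integral_def
    by (subst (asm) lborel_integral_real_affine[of "-1" _ pi]) (simp_all add: ind[simplified])
  show "(cmod (value_0 f))\<^sup>2 \<le> 16 / \<delta> ^ 3 * (H_norm f)\<^sup>2 + 8 * \<delta> * (H_norm (weak_deriv f))\<^sup>2"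
    using trace_inequality[OF zero_le_power2 \<delta> value_0_limit(2)[OF f]] wi wN by (simp add: w_def[abs_def])
  show "(cmod (value_pi f))\<^sup>2 \<le> 16 / \<delta> ^ 3 * (H_norm f)\<^sup>2 + 8 * \<delta> * (H_norm (weak_deriv f))\<^sup>2"
    using trace_inequality[where v = "\<lambda>t. cont_rep f (pi - t)", OF zero_le_power2 \<delta> value_pi_limit(2)[OF f]] ri rN
    by (simp add: w_def[abs_def] omega_reflect)
qed

text \<open>
  Absorbing the boundary term into the energy requires \<open>b \<delta>\<close> to be bounded, so \<open>\<delta>\<close> is chosen of
  order \<open>1 / (1 + b)\<close>; the price is \<open>b / \<delta>\<^sup>3\<close>, and this is where the fourth power comes from.
\<close>

lemma boundary_term_bound:
  fixes b N E T :: real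
  assumes b: "0 \<le> b" and N: "0 \<le> N" and E: "0 \<le> E"
    and T: "\<And>\<delta>. 0 < \<delta> \<Longrightarrow> \<delta> \<le> 1 \<Longrightarrow> T \<le> 16 / \<delta> ^ 3 * N + 8 * \<delta> * E"
  shows "b * T \<le> 2 * E + 8192 * (1 + b ^ 4) * N"
proof -
  define \<delta> where "\<delta> = 1 / (4 * (1 + b))"
  have \<delta>: "0 < \<delta>" "\<delta> \<le> 1" using b by (auto simp: \<delta>_def)
  have "b * T \<le> b * (16 / \<delta> ^ 3 * N + 8 * \<delta> * E)"
    using b T[OF \<delta>] by (rule mult_left_mono[rotated])
  also have "\<dots> = b * (1024 * (1 + b) ^ 3) * N + (2 * b / (1 + b)) * E"
  proof -
    have "16 / \<delta> ^ 3 = 1024 * (1 + b) ^ 3" by (simp add: \<delta>_def power_divide power_mult_distrib del: distrib_left_numeral)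
    moreover have "8 * \<delta> = 2 / (1 + b)" by (simp add: \<delta>_def del: distrib_left_numeral)
    ultimately show ?thesis by (simp add: algebra_simps)
  qed
  also have "(2 * b / (1 + b)) * E \<le> 2 * E"
    using b E by (intro mult_right_mono) (auto simp: divide_le_eq)
  also have "b * (1024 * (1 + b) ^ 3) * N \<le> 8192 * (1 + b ^ 4) * N"
  proof (rule mult_right_mono[OF _ N])
    have sq: "(1 + x)\<^sup>2 \<le> 2 * (1 + x\<^sup>2)" for x :: real
      using zero_le_power2[of "1 - x"] by (simp add: power2_eq_square algebra_simps)
    have "(1 + b) ^ 4 = ((1 + b)\<^sup>2)\<^sup>2" by simp
    also have "\<dots> \<le> (2 * (1 + b\<^sup>2))\<^sup>2" by (intro power_mono sq) auto
    also have "\<dots> = 4 * (1 + b\<^sup>2)\<^sup>2" by (simp add: power_mult_distrib del: distrib_left_numeral)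
    also have "\<dots> \<le> 8 * (1 + b ^ 4)" using sq[of "b\<^sup>2"] by simp
    finally have "(1 + b) ^ 4 \<le> 8 * (1 + b ^ 4)" .
    moreover have "b * (1 + b) ^ 3 \<le> (1 + b) * (1 + b) ^ 3" using b by (intro mult_right_mono) auto
    moreover have "(1 + b) * (1 + b) ^ 3 = (1 + b) ^ 4" by (simp add: power_Suc[symmetric] del: power_Suc)
    ultimately show "b * (1024 * (1 + b) ^ 3) \<le> 8192 * (1 + b ^ 4)" by linarith
  qed
  finally show ?thesis by simp
qed

lemma Re_robin_form_self:
  assumes "f \<in> form_dom"
  shows "Re (robin_form (b, b') f f) = 4 * (H_norm (weak_deriv f))\<^sup>2 + b * (cmod (value_0 f))\<^sup>2 + b' * (cmod (value_pi f))\<^sup>2"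
  using form0_eq_H_inner[OF assms assms]
  by (simp add: H_inner_self mult.assoc flip: complex_norm_square)

text \<open>
  Each endpoint uses up half of the energy \<open>4 \<parallel>f'\<parallel>\<^sup>2\<close> of the unperturbed form. The final constant
  is doubled because the summand \<open>1\<close> occurs once for each endpoint.
\<close>

lemma robin_form_lower_bound:
  assumes f: "f \<in> form_dom"
  shows "Re (robin_form (b, b') f f) \<ge> - 16384 * (1 + \<bar>neg_part b\<bar> ^ 4 + \<bar>neg_part b'\<bar> ^ 4) * (H_norm f)\<^sup>2"
proof -
  define E N where "E = (H_norm (weak_deriv f))\<^sup>2" and "N = (H_norm f)\<^sup>2"
  have EN: "0 \<le> E" "0 \<le> N" by (auto simp: E_def N_def)
  have n: "0 \<le> neg_part c" "- neg_part c \<le> c" for c by (auto simp: neg_part_def)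
  have 1: "neg_part b * (cmod (value_0 f))\<^sup>2 \<le> 2 * E + 8192 * (1 + neg_part b ^ 4) * N"
    using endpoint_trace_inequality(1)[OF f] by (intro boundary_term_bound n EN) (auto simp: E_def N_def)
  have 2: "neg_part b' * (cmod (value_pi f))\<^sup>2 \<le> 2 * E + 8192 * (1 + neg_part b' ^ 4) * N"
    using endpoint_trace_inequality(2)[OF f] by (intro boundary_term_bound n EN) (auto simp: E_def N_def)
  have 3: "- neg_part b * (cmod (value_0 f))\<^sup>2 \<le> b * (cmod (value_0 f))\<^sup>2"
    "- neg_part b' * (cmod (value_pi f))\<^sup>2 \<le> b' * (cmod (value_pi f))\<^sup>2"
    by (intro mult_right_mono n zero_le_power2)+
  have "0 \<le> 8192 * (neg_part b ^ 4 + neg_part b' ^ 4) * N" using EN n by simp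
  then show ?thesis
    unfolding Re_robin_form_self[OF f] E_def[symmetric] N_def[symmetric]
    using 1 2 3 by (simp add: n algebra_simps)
qed

section \<open>The bottom of the spectrum\<close>

lemma robin_form_combination:
  assumes f: "f \<in> form_dom" and g: "g \<in> form_dom" and k: "k \<in> form_dom"
  shows "robin_form \<beta> (\<lambda>x. f x + c * g x) k = robin_form \<beta> f k + c * robin_form \<beta> g k"
proof -
  obtain b b' where \<beta>: "\<beta> = (b, b')" by force
  note h = form_dom_combination[OF f g, of c]
  note ms = H_spaceD(1)
  have "H_inner (weak_deriv (\<lambda>x. f x + c * g x)) (weak_deriv k)
      = H_inner (\<lambda>x. weak_deriv f x + c * weak_deriv g x) (weak_deriv k)"
    using H1_loc_combination(2)[OF form_domD(2)[OF f] form_domD(2)[OF g], of c]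
    by (intro H_inner_cong_AE ms form_domD(3) h k H_space_combination f g AE_wleb) auto
  also have "\<dots> = H_inner (weak_deriv f) (weak_deriv k) + c * H_inner (weak_deriv g) (weak_deriv k)"
    by (intro H_inner_combination form_domD(3) f g k)
  finally show ?thesis
    using endpoint_values_combination[OF f g, of c]
    by (simp add: \<beta> form0_eq_H_inner f g k h algebra_simps)
qed

lemma robin_form_commute:
  assumes f: "f \<in> form_dom" and g: "g \<in> form_dom"
  shows "robin_form \<beta> g f = cnj (robin_form \<beta> f g)"
proof -
  obtain b b' where \<beta>: "\<beta> = (b, b')" by force
  show ?thesis
    using H_inner_commute[of "weak_deriv g" "weak_deriv f"]
    by (simp add: \<beta> form0_eq_H_inner f g mult_ac)
qed

text \<open>
  Let \<open>B\<close> be the form shifted by \<open>\<kappa>\<close>, which is nonnegative, and let \<open>K\<close> bound the inverse of the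
  shifted operator. For \<open>f\<close> in the form domain solve \<open>(A - \<kappa>) u = f\<close>; then \<open>B[u, f] = \<parallel>f\<parallel>\<^sup>2\<close> and
  \<open>B[u, u] = \<langle>f, u\<rangle> \<le> K \<parallel>f\<parallel>\<^sup>2\<close>. Expanding \<open>0 \<le> B[u - K f, u - K f]\<close> yields \<open>B[f, f] \<ge> \<parallel>f\<parallel>\<^sup>2 / K\<close>:
  a lower bound that belongs to the resolvent set is never the best one.
\<close>

lemma resolvent_point_improves_lower_bound:
  assumes lower: "\<And>f. f \<in> form_dom \<Longrightarrow> \<kappa> * (H_norm f)\<^sup>2 \<le> Re (robin_form \<beta> f f)"
    and res: "complex_of_real \<kappa> \<in> resolvent_set (robin_op \<beta>)"
  obtains \<epsilon> where "0 < \<epsilon>" "\<And>f. f \<in> form_dom \<Longrightarrow> (\<kappa> + \<epsilon>) * (H_norm f)\<^sup>2 \<le> Re (robin_form \<beta> f f)"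
proof -
  obtain K0 where K0: "\<forall>(f, k)\<in>robin_op \<beta>. H_norm f \<le> K0 * H_norm (\<lambda>\<phi>. k \<phi> - of_real \<kappa> * f \<phi>)"
    and surj: "\<forall>h\<in>H_space. \<exists>(f, k)\<in>robin_op \<beta>. AE \<phi> in wleb. k \<phi> - of_real \<kappa> * f \<phi> = h \<phi>"
    using res by (auto simp: resolvent_set_def)
  \<comment> \<open>The constant in the definition of the resolvent set may be nonpositive.\<close>
  define K where "K = max K0 1"
  have K: "0 < K" "K0 \<le> K" by (auto simp: K_def)
  have "(\<kappa> + 1 / K) * (H_norm f)\<^sup>2 \<le> Re (robin_form \<beta> f f)" if f: "f \<in> form_dom" for f
  proof -
    note fH = form_domD(1)[OF f]
    obtain u k where uk: "(u, k) \<in> robin_op \<beta>" and AE: "AE \<phi> in wleb. k \<phi> - of_real \<kappa> * u \<phi> = f \<phi>"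
      using surj fH by fast
    have u: "u \<in> form_dom" and kH: "k \<in> H_space"
      and rep: "\<And>g. g \<in> form_dom \<Longrightarrow> robin_form \<beta> u g = H_inner k g"
      using uk by (auto simp: robin_op_def)
    note uH = form_domD(1)[OF u]
    note m[measurable] = H_spaceD(1)[OF fH] H_spaceD(1)[OF uH] H_spaceD(1)[OF kH]
    have "H_norm (\<lambda>\<phi>. k \<phi> - of_real \<kappa> * u \<phi>) = H_norm f"
      unfolding H_norm_def using AE by (intro arg_cong[where f = sqrt] integral_cong_AE) auto
    then have "H_norm u \<le> K0 * H_norm f" using K0 uk by force
    also have "\<dots> \<le> K * H_norm f" using K by (intro mult_right_mono H_norm_nonneg)
    finally have nu: "(H_norm u)\<^sup>2 \<le> K\<^sup>2 * (H_norm f)\<^sup>2"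
      using power_mono[OF _ H_norm_nonneg, of u "K * H_norm f" 2] by (simp add: power_mult_distrib)
    define B where "B f g = robin_form \<beta> f g - of_real \<kappa> * H_inner f g" for f g
    have B_comb: "B (\<lambda>x. p x + c * q x) r = B p r + c * B q r"
      if "p \<in> form_dom" "q \<in> form_dom" "r \<in> form_dom" for p q r c
      using that by (simp add: B_def robin_form_combination H_inner_combination form_domD algebra_simps)
    have B_comm: "B q p = cnj (B p q)" if "p \<in> form_dom" "q \<in> form_dom" for p q
      using robin_form_commute[OF that, of \<beta>] H_inner_commute[of q p] by (simp add: B_def)
    have Bu: "B u g = H_inner f g" if g: "g \<in> form_dom" for g
    proof -
      note gH = form_domD(1)[OF g]
      have "H_inner f g = H_inner (\<lambda>x. k x + (- of_real \<kappa>) * u x) g"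
        using AE H_spaceD(1)[OF gH] by (intro H_inner_cong_AE) auto
      also have "\<dots> = H_inner k g + (- of_real \<kappa>) * H_inner u g"
        by (rule H_inner_combination[OF kH uH gH])
      finally show ?thesis by (simp add: B_def rep[OF g])
    qed
    define h where "h = (\<lambda>x. u x + (- of_real K) * f x)"
    have h: "h \<in> form_dom" unfolding h_def by (rule form_dom_combination[OF u f])
    have Bh: "B h g = B u g - of_real K * B f g" if "g \<in> form_dom" for g
      using B_comb[OF u f that, of "- of_real K"] by (simp add: h_def)
    have "B h u = B u u - of_real K * B f u" "B h f = B u f - of_real K * B f f"
      "B h h = B u h - of_real K * B f h"
      by (rule Bh[OF u] Bh[OF f] Bh[OF h])+
    then have "B h h = cnj (B u u - of_real K * cnj (B u f)) - of_real K * cnj (B u f - of_real K * B f f)"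
      using B_comm[OF h u] B_comm[OF h f] B_comm[OF u f] by simp
    then have "Re (B h h) = Re (H_inner f u) - 2 * K * (H_norm f)\<^sup>2 + K\<^sup>2 * Re (B f f)"
      unfolding Bu[OF u] Bu[OF f] H_inner_self by (simp add: power2_eq_square right_diff_distrib)
    moreover have "0 \<le> Re (B h h)" using lower[OF h] by (simp add: B_def H_inner_self)
    moreover have "Re (H_inner f u) \<le> K * (H_norm f)\<^sup>2"
    proof -
      have "Re (H_inner f u) \<le> K / 2 * (H_norm f)\<^sup>2 + 1 / (2 * K) * (H_norm u)\<^sup>2"
        by (rule Re_H_inner_le[OF fH uH K(1)])
      also have "\<dots> \<le> K / 2 * (H_norm f)\<^sup>2 + 1 / (2 * K) * (K\<^sup>2 * (H_norm f)\<^sup>2)"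
        using K nu by (intro add_left_mono mult_left_mono) auto
      also have "\<dots> = K * (H_norm f)\<^sup>2" using K by (simp add: power2_eq_square)
      finally show ?thesis .
    qed
    ultimately have "K * (H_norm f)\<^sup>2 \<le> K\<^sup>2 * Re (B f f)" by simp
    then have "1 / K * (H_norm f)\<^sup>2 \<le> Re (B f f)"
      using K by (simp add: power2_eq_square field_simps)
    then show ?thesis by (simp add: B_def H_inner_self algebra_simps)
  qed
  with K that[of "1 / K"] show ?thesis by simp
qed

text \<open>
  The best lower bound of the form exists by semiboundedness, lies below every Rayleigh quotient,
  and is a point of the spectrum, since a resolvent point could be improved.
\<close>

lemma inf_spectrum_le_Rayleigh_quotient:
  assumes f: "f \<in> form_dom" and nz: "H_norm f \<noteq> 0"
    and R: "Re (robin_form \<beta> f f) \<le> r * (H_norm f)\<^sup>2"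
  shows "inf_spectrum (robin_op \<beta>) \<le> ereal r"
proof -
  obtain b b' where \<beta>: "\<beta> = (b, b')" by force
  define \<Lambda> where "\<Lambda> = {\<kappa>. \<forall>g\<in>form_dom. \<kappa> * (H_norm g)\<^sup>2 \<le> Re (robin_form \<beta> g g)}"
  have "- 16384 * (1 + \<bar>neg_part b\<bar> ^ 4 + \<bar>neg_part b'\<bar> ^ 4) \<in> \<Lambda>"
    unfolding \<Lambda>_def \<beta> using robin_form_lower_bound by blast
  then have ne: "\<Lambda> \<noteq> {}" by blast
  have le: "\<kappa> \<le> r" if "\<kappa> \<in> \<Lambda>" for \<kappa>
  proof -
    have "\<kappa> * (H_norm f)\<^sup>2 \<le> r * (H_norm f)\<^sup>2" using that f R by (force simp: \<Lambda>_def)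
    then show ?thesis using nz by simp
  qed
  then have bdd: "bdd_above \<Lambda>" by (rule bdd_aboveI)
  define \<kappa>\<^sub>0 where "\<kappa>\<^sub>0 = Sup \<Lambda>"
  have lower: "\<kappa>\<^sub>0 * (H_norm g)\<^sup>2 \<le> Re (robin_form \<beta> g g)" if g: "g \<in> form_dom" for g
  proof (cases "H_norm g = 0")
    case True
    then show ?thesis using ne g by (auto simp: \<Lambda>_def)
  next
    case False
    then have pos: "0 < (H_norm g)\<^sup>2" by simp
    have "\<kappa>\<^sub>0 \<le> Re (robin_form \<beta> g g) / (H_norm g)\<^sup>2"
      unfolding \<kappa>\<^sub>0_def using ne g pos by (intro cSup_least) (auto simp: \<Lambda>_def pos_le_divide_eq)
    then show ?thesis using pos by (simp add: pos_le_divide_eq)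
  qed
  have "complex_of_real \<kappa>\<^sub>0 \<notin> resolvent_set (robin_op \<beta>)"
  proof
    assume "complex_of_real \<kappa>\<^sub>0 \<in> resolvent_set (robin_op \<beta>)"
    then obtain \<epsilon> where "0 < \<epsilon>"
      and "\<And>g. g \<in> form_dom \<Longrightarrow> (\<kappa>\<^sub>0 + \<epsilon>) * (H_norm g)\<^sup>2 \<le> Re (robin_form \<beta> g g)"
      by (rule resolvent_point_improves_lower_bound[OF lower, rotated]) auto
    then have "\<kappa>\<^sub>0 + \<epsilon> \<in> \<Lambda>" by (simp add: \<Lambda>_def)
    then show False using cSup_upper[OF _ bdd, of "\<kappa>\<^sub>0 + \<epsilon>"] \<open>0 < \<epsilon>\<close> by (simp add: \<kappa>\<^sub>0_def)
  qed
  then have "inf_spectrum (robin_op \<beta>) \<le> ereal \<kappa>\<^sub>0"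
    unfolding inf_spectrum_def by (intro INF_lower) (simp add: spectrum_def)
  also have "\<kappa>\<^sub>0 \<le> r" unfolding \<kappa>\<^sub>0_def using ne le by (rule cSup_least)
  finally show ?thesis by simp
qed

section \<open>A trial function concentrated at the endpoint\<close>

definition decay :: "real \<Rightarrow> real \<Rightarrow> complex" where
  "decay a x = of_real (exp (- (a * x)))"

lemma continuous_in_L2_loc:
  fixes v :: "real \<Rightarrow> complex"
  assumes "continuous_on UNIV v" shows "v \<in> L2_loc"
proof -
  have [measurable]: "v \<in> borel_measurable borel" using assms by (rule borel_measurable_continuous_onI)
  have "set_integrable leb K (\<lambda>x. (cmod (v x))\<^sup>2)" if K: "compact K" "K \<subseteq> {0<..<pi}" for K
  proof -
    have "integrable lborel (\<lambda>x. indicator K x *\<^sub>R (cmod (v x))\<^sup>2)"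
      using K(1) by (intro borel_integrable_compact continuous_intros continuous_on_subset[OF assms]) auto
    moreover have "indicator {0<..<pi} x *\<^sub>R indicator K x *\<^sub>R (cmod (v x))\<^sup>2 = indicator K x *\<^sub>R (cmod (v x))\<^sup>2" for x
      using K(2) by (auto simp: indicator_def)
    ultimately show ?thesis unfolding set_integrable_def leb_integrable by (simp only:)
  qed
  moreover have "v \<in> borel_measurable leb" by (rule measurable_leb_borel) measurable
  ultimately show ?thesis by (simp add: L2_loc_def)
qed

lemma omega_square_integrable:
  fixes v :: "real \<Rightarrow> complex"
  assumes c: "continuous_on UNIV v"
  shows "set_integrable lborel {0<..<pi} (\<lambda>x. omega x * (cmod (v x))\<^sup>2)"
proof (rule set_integrable_subset)
  show "set_integrable lborel {0..pi} (\<lambda>x. omega x * (cmod (v x))\<^sup>2)"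
    unfolding omega_def by (intro borel_integrable_atLeastAtMost' continuous_intros continuous_on_subset[OF c]) auto
qed auto

lemma continuous_in_H_space:
  fixes v :: "real \<Rightarrow> complex"
  assumes c: "continuous_on UNIV v" shows "v \<in> H_space"
proof -
  have m[measurable]: "v \<in> borel_measurable leb"
    using continuous_in_L2_loc[OF c] by (simp add: L2_loc_def)
  show ?thesis using omega_square_integrable[OF c]
    unfolding H_space_def measurable_wleb by (simp add: wleb_integrable m leb_integrable)
qed

lemma decay_continuous: "continuous_on S (\<lambda>x. c * decay a x)"
  unfolding decay_def by (intro continuous_intros)

lemma decay_form_dom:
  shows "decay a \<in> form_dom"
    and "AE x in leb. weak_deriv (decay a) x = - of_real a * decay a x"
    and "value_0 (decay a) = 1"
proof -
  let ?d = "\<lambda>x. - of_real a * decay a x"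
  have c: "continuous_on S (decay a)" for S using decay_continuous[of S 1 a] by simp
  have L2: "decay a \<in> L2_loc" "?d \<in> L2_loc"
    by (intro continuous_in_L2_loc c decay_continuous)+
  have "decay a y - decay a x = integral {x..y} ?d" if "x \<le> y" for x y
  proof -
    have "(decay a has_vector_derivative ?d t) (at t within {x..y})" for t
      unfolding decay_def
      by (auto intro!: derivative_eq_intros has_vector_derivative_real_field simp: exp_of_real[symmetric])
    then have "(?d has_integral (decay a y - decay a x)) {x..y}"
      by (intro fundamental_theorem_of_calculus that)
    then show ?thesis by (rule integral_unique[symmetric])
  qed
  then have wd: "is_weak_deriv (decay a) ?d"
    by (intro primitive_weak_deriv L2_loc_imp_locally_integrable L2 c) auto
  then have H1: "decay a \<in> H1_loc" using L2 by (auto simp: H1_loc_def)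
  show AE: "AE x in leb. weak_deriv (decay a) x = ?d x"
    by (rule weak_deriv_unique[OF weak_derivD[OF H1] L2(2) wd])
  show dom: "decay a \<in> form_dom"
    by (rule form_domI[OF _ H1 _ AE]) (intro continuous_in_H_space c decay_continuous)+
  have "eventually (\<lambda>x. x \<in> {0<..<pi}) (at_right 0)"
    by (intro eventually_at_right_real) simp
  then have ev: "eventually (\<lambda>x. decay a x = cont_rep (decay a) x) (at_right 0)"
    by eventually_elim (rule cont_rep_eqI[OF H1 c _, symmetric], auto)
  have "(decay a \<longlongrightarrow> decay a 0) (at 0 within {0..})"
    using c[of "{0..}"] by (simp add: continuous_on_def)
  then have "(decay a \<longlongrightarrow> decay a 0) (at_right 0)"
    by (rule tendsto_within_subset) auto
  from tendsto_unique[OF trivial_limit_at_right_real value_0_limit(1)[OF dom]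
      Lim_transform_eventually[OF this ev]]
  show "value_0 (decay a) = 1" by (simp add: decay_def)
qed

text \<open>
  The rate is written as \<open>m\<^sup>2\<close> to avoid square roots. From \<open>m \<surd>x \<le> exp (m\<^sup>2 x)\<close> and \<open>\<omega> x \<le> \<surd>x\<close>
  the integrand is at most \<open>exp (- m\<^sup>2 x) / m\<close>, whose integral over the half line is \<open>1 / m\<^sup>3\<close>.
\<close>

lemma decay_norm:
  assumes m: "0 < m"
  shows "(H_norm (decay (m\<^sup>2)))\<^sup>2 \<le> 1 / m ^ 3"
proof -
  have c: "continuous_on UNIV (decay (m\<^sup>2))" using decay_continuous[of UNIV 1] by simp
  have meas[measurable]: "decay (m\<^sup>2) \<in> borel_measurable leb"
    using continuous_in_L2_loc[OF c] by (simp add: L2_loc_def)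
  define F where "F x = - exp (- (m\<^sup>2 * x)) / m ^ 3" for x
  define q where "q x = exp (- (m\<^sup>2 * x)) / m" for x
  have F: "(F has_real_derivative q x) (at x)" for x
    unfolding F_def q_def using m by (auto intro!: derivative_eq_intros simp: power2_eq_square power3_eq_cube)
  have qi: "set_integrable lborel {0..pi} q"
    unfolding q_def using m by (intro borel_integrable_atLeastAtMost' continuous_intros) auto
  have le: "omega x * (cmod (decay (m\<^sup>2) x))\<^sup>2 \<le> q x" if x: "x \<in> {0<..<pi}" for x
  proof -
    have "m * sqrt x = sqrt (m\<^sup>2 * x)" using m by (simp add: real_sqrt_mult)
    also have "\<dots> \<le> 1 + m\<^sup>2 * x"
      using m x by (intro real_le_lsqrt) (auto simp: power2_eq_square algebra_simps)
    also have "\<dots> \<le> exp (m\<^sup>2 * x)" by (rule exp_ge_add_one_self)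
    finally have "sqrt x \<le> exp (m\<^sup>2 * x) / m" using m by (simp add: field_simps)
    moreover have "omega x \<le> sqrt x" using x sin_x_le_x[of x] by (simp add: omega_def)
    ultimately have "omega x * (cmod (decay (m\<^sup>2) x))\<^sup>2 \<le> exp (m\<^sup>2 * x) / m * (exp (- (m\<^sup>2 * x)))\<^sup>2"
      using m by (intro mult_mono) (auto simp: decay_def)
    also have "\<dots> = q x" by (simp add: q_def power2_eq_square flip: exp_add)
    finally show ?thesis .
  qed
  have "(H_norm (decay (m\<^sup>2)))\<^sup>2 = (LINT x:{0<..<pi}|lborel. omega x * (cmod (decay (m\<^sup>2) x))\<^sup>2)"
    unfolding H_norm_sq by (subst wleb_integral) (auto simp: leb_integral)
  also have "\<dots> \<le> (LINT x:{0<..<pi}|lborel. q x)"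
    using omega_square_integrable[OF c] qi by (intro set_integral_mono le) (auto intro: set_integrable_subset)
  also have "\<dots> \<le> (LINT x:{0..pi}|lborel. q x)"
    using m by (intro set_integral_mono_domain qi set_integrable_subset[OF qi]) (auto, simp add: q_def)
  also have "\<dots> = F pi - F 0"
    unfolding set_lebesgue_integral_def using m
    by (intro integral_FTC_Icc)
      (auto simp: q_def intro!: continuous_intros DERIV_subset[OF F, unfolded q_def] simp flip: has_real_derivative_iff_has_vector_derivative)
  also have "\<dots> \<le> 1 / m ^ 3" using m by (simp add: F_def)
  finally show ?thesis .
qed

text \<open>
  The derivative multiplies the trial function by \<open>- m\<^sup>2\<close>, so its energy is at most
  \<open>4 m\<^sup>4 / m\<^sup>3 = 4 m\<close>, half of what the boundary term \<open>- 8 m\<close> takes away. A negative value of a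
  semibounded form also shows that the trial function is not zero in the Hilbert space.
\<close>

lemma decay_Rayleigh_quotient:
  assumes m: "0 < m"
  shows "Re (robin_form (- 8 * m, 0) (decay (m\<^sup>2)) (decay (m\<^sup>2))) \<le> - 4 * m"
    and "H_norm (decay (m\<^sup>2)) \<noteq> 0"
proof -
  let ?e = "decay (m\<^sup>2)"
  note e = decay_form_dom[of "m\<^sup>2"]
  have "H_inner (weak_deriv ?e) (weak_deriv ?e) = H_inner (\<lambda>x. - of_real (m\<^sup>2) * ?e x) (\<lambda>x. - of_real (m\<^sup>2) * ?e x)"
    using AE_wleb[OF e(2)] by (intro H_inner_cong_AE H_spaceD(1) form_domD(3)[OF e(1)] continuous_in_H_space decay_continuous)
  also have "\<dots> = of_real (m ^ 4) * H_inner ?e ?e"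
    by (simp add: H_inner_def mult_ac power2_eq_square power4_eq_xxxx flip: integral_mult_right_zero)
  finally have "(H_norm (weak_deriv ?e))\<^sup>2 = m ^ 4 * (H_norm ?e)\<^sup>2"
    unfolding H_inner_self of_real_mult[symmetric] of_real_eq_iff .
  also have "\<dots> \<le> m ^ 4 * (1 / m ^ 3)" using m by (intro mult_left_mono decay_norm) auto
  also have "\<dots> = m" using m by (simp add: power4_eq_xxxx power3_eq_cube)
  finally show R: "Re (robin_form (- 8 * m, 0) ?e ?e) \<le> - 4 * m"
    by (subst Re_robin_form_self[OF e(1)]) (simp add: e(3))
  show "H_norm ?e \<noteq> 0"
  proof
    assume "H_norm ?e = 0"
    then have "0 \<le> Re (robin_form (- 8 * m, 0) ?e ?e)"
      using robin_form_lower_bound[OF e(1), of "- 8 * m" 0] by simp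
    with R m show False by simp
  qed
qed

theorem theorem7p1:
  shows "(\<exists>C>0. \<forall>\<beta>\<^sub>0 \<beta>\<^sub>\<pi>. \<forall>f\<in>form_dom.
            Re (robin_form (\<beta>\<^sub>0, \<beta>\<^sub>\<pi>) f f)
              \<ge> - C * (1 + \<bar>neg_part \<beta>\<^sub>0\<bar> ^ 4 + \<bar>neg_part \<beta>\<^sub>\<pi>\<bar> ^ 4) * (H_norm f)\<^sup>2) \<and>
         (\<exists>c>0. \<exists>\<mu>\<^sub>0>0. \<forall>\<mu>\<ge>\<mu>\<^sub>0.
            inf_spectrum (robin_op (- \<mu>, 0)) \<le> ereal (- c * \<mu> ^ 4))"
proof
  show "\<exists>C>0. \<forall>\<beta>\<^sub>0 \<beta>\<^sub>\<pi>. \<forall>f\<in>form_dom. Re (robin_form (\<beta>\<^sub>0, \<beta>\<^sub>\<pi>) f f)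
      \<ge> - C * (1 + \<bar>neg_part \<beta>\<^sub>0\<bar> ^ 4 + \<bar>neg_part \<beta>\<^sub>\<pi>\<bar> ^ 4) * (H_norm f)\<^sup>2"
    using robin_form_lower_bound by (intro exI[of _ 16384]) auto
  have "inf_spectrum (robin_op (- \<mu>, 0)) \<le> ereal (- (1 / 1024) * \<mu> ^ 4)" if "1 \<le> \<mu>" for \<mu> :: real
  proof -
    \<comment> \<open>The decay rate \<open>m\<^sup>2\<close> is of order \<open>\<mu>\<^sup>2\<close>, matching the length scale \<open>\<delta>\<^sup>2\<close> of the lower bound.\<close>
    define m where "m = \<mu> / 8"
    have m: "0 < m" using that by (simp add: m_def)
    have "m ^ 4 * (H_norm (decay (m\<^sup>2)))\<^sup>2 \<le> m ^ 4 * (1 / m ^ 3)"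
      using m by (intro mult_left_mono decay_norm) auto
    also have "\<dots> = m" using m by (simp add: power4_eq_xxxx power3_eq_cube)
    finally have "Re (robin_form (- 8 * m, 0) (decay (m\<^sup>2)) (decay (m\<^sup>2))) \<le> (- 4 * m ^ 4) * (H_norm (decay (m\<^sup>2)))\<^sup>2"
      using decay_Rayleigh_quotient(1)[OF m] by linarith
    then have "inf_spectrum (robin_op (- 8 * m, 0)) \<le> ereal (- 4 * m ^ 4)"
      by (rule inf_spectrum_le_Rayleigh_quotient[OF decay_form_dom(1) decay_Rayleigh_quotient(2)[OF m]])
    then show ?thesis by (simp add: m_def power_divide)
  qed
  then show "\<exists>c>0. \<exists>\<mu>\<^sub>0>0. \<forall>\<mu>\<ge>\<mu>\<^sub>0. inf_spectrum (robin_op (- \<mu>, 0)) \<le> ereal (- c * \<mu> ^ 4)"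
    by (intro exI[of _ "1 / 1024"] exI[of _ 1] conjI) auto
qed

end
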